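(* Let $n$ be an even positive integer and $p$ a prime with $p^r\,\|\,n$ for some $r\ge1$ and $p-1\nmid n$. Let $l\equiv n\pmod{p-1}$ with $0<l<p-1$. Then $p^{r+\delta}\,\|\,B_n$, where: (1) if $p$ is regular, $\delta=0$; (2) if $p$ is irregular and $(p,l)\notin\Psi^{\rm irr}_1$, $\delta=0$; (3) if $p$ is irregular, $(p,l)\in\Psi^{\rm irr}_1$ and $\Delta_{(p,l)}\neq0$, then $\delta=1+\mathrm{ord}_p\big(\chi_{(p,l)}-\frac{n-l}{p-1}\big)$; (4) if $p$ is irregular, $(p,l)\in\Psi^{\rm irr}_1$ and $\Delta_{(p,l)}=0$, then $\delta=1+h_0(p,n)$. Additionally, in case (3) and in case (4): if $(p,l,l)\notin\widehat\Psi^{\rm irr}_2$ then $\delta=1$, and otherwise $\delta\ge2$.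
   Context: $B_n$ are the Bernoulli numbers, $\frac{z}{e^z-1}=\sum_{n\ge0}B_n\frac{z^n}{n!}$; $p^k\,\|\,x$ means $\mathrm{ord}_p x=k$. An odd prime $p$ is irregular if $p\mid B_k$ for some $k\in\{2,4,\dots,p-3\}$, regular otherwise. $\varphi$ is Euler's totient. For $m\ge1$, $\Psi^{\rm irr}_m=\{(p,l): p \text{ odd prime},\ p^m\mid B_l/l,\ 2\le l<\varphi(p^m),\ l\text{ even}\}$ (with $p^m\mid B_l/l$ meaning $\mathrm{ord}_p(B_l/l)\ge m$). A pair $(p,l)\in\Psi^{\rm irr}_m$ is written $(p,s_1,\dots,s_m)$ with $l=\sum_{\nu=1}^m s_\nu\varphi(p^{\nu-1})$, $0\le s_\nu<p$, $s_1$ even, $2\le s_1\le p-3$; these tuples form $\widehat\Psi^{\rm irr}_m$ (so $(p,l,l)\in\widehat\Psi^{\rm irr}_2$ means $(p,lp)\in\Psi^{\rm irr}_2$). For $(p,l)\in\Psi^{\rm irr}_m$, $\Delta_{(p,l)}\in\{0,\dots,p-1\}$ with $\Delta_{(p,l)}\equiv p^{-m}\big(\frac{B_{l+\varphi(p^m)}}{l+\varphi(p^m)}-\frac{B_l}{l}\big)\pmod p$. If $(p,l)\in\Psi^{\rm irr}_1$ and $\Delta_{(p,l)}\neq0$, there is (known) a unique sequence $(s_\nu)_{\nu\ge1}$ with $s_1=l$ and $(p,s_1,\dots,s_m)\in\widehat\Psi^{\rm irr}_m$ for all $m$; $\chi_{(p,l)}=\sum_{\nu\ge0}s_{\nu+2}p^\nu\in\mathbb{Z}_p$.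 If $(p,l)\in\Psi^{\rm irr}_1$ and $\Delta_{(p,l)}=0$, the rooted tree $T^0_{(p,l)}$ is defined recursively: root $(p,l)$ of height $0$; a node $(p,l')$ of height $r$ has no children if $(p,l')\notin\Psi^{\rm irr}_{r+2}$, and otherwise has the $p$ children $(p,l'+j\varphi(p^{r+1}))$, $j=0,\dots,p-1$, of height $r+1$; the tree is trivial if it is only the root. For $n\equiv l\pmod{p-1}$, $h_0(p,n)$ is the maximal height of a node $(p,l')$ of $T^0_{(p,l)}$ with $l'$ equal to the least nonnegative residue of $n$ modulo $\varphi(p^\nu)$ for some $\nu\ge1$. *)

theory Defs
  imports
    "HOL-Number_Theory.Number_Theory"
    "HOL-Computational_Algebra.Computational_Algebra"
    "HOL-Library.Extended_Nat"
begin

text \<open>The generating function \<open>z / (e^z - 1)\<close> is taken in the formal power series over the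
  rationals.\<close>

definition bernoulli :: "nat \<Rightarrow> rat" where
  "bernoulli n = fact n * fps_nth (fps_X / (fps_exp 1 - 1)) n"

text \<open>\<open>rat_ord p x\<close> is meaningful for prime \<open>p\<close> and \<open>x \<noteq> 0\<close> only; the convention
  \<open>ord 0 = \<infinity>\<close> is built into the two predicates that follow it, which are
  \<open>ord x \<ge> m\<close> and \<open>ord x = m\<close>.\<close>

definition rat_ord :: "nat \<Rightarrow> rat \<Rightarrow> int" where
  "rat_ord p x = int (multiplicity (int p) (fst (quotient_of x)))
               - int (multiplicity (int p) (snd (quotient_of x)))"

definition ppow_dvd :: "nat \<Rightarrow> nat \<Rightarrow> rat \<Rightarrow> bool" where
  "ppow_dvd p m x \<longleftrightarrow> x = 0 \<or> rat_ord p x \<ge> int m"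

definition ppow_exact :: "nat \<Rightarrow> nat \<Rightarrow> rat \<Rightarrow> bool" where
  "ppow_exact p m x \<longleftrightarrow> x \<noteq> 0 \<and> rat_ord p x = int m"

definition irregular_prime :: "nat \<Rightarrow> bool" where
  "irregular_prime p \<longleftrightarrow> prime p \<and> odd p \<and>
     (\<exists>k. even k \<and> 2 \<le> k \<and> k \<le> p - 3 \<and> ppow_dvd p 1 (bernoulli k))"

definition regular_prime :: "nat \<Rightarrow> bool" where
  "regular_prime p \<longleftrightarrow> prime p \<and> odd p \<and> \<not> irregular_prime p"

definition Psi_irr :: "nat \<Rightarrow> (nat \<times> nat) set" where
  "Psi_irr m = {(p, l). prime p \<and> odd p \<and> ppow_dvd p m (bernoulli l / of_nat l) \<and>
                        2 \<le> l \<and> l < totient (p ^ m) \<and> even l}"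

text \<open>The tuple \<open>(p, s\<^sub>1, \<dots>, s\<^sub>m)\<close> is the pair \<open>(p, [s\<^sub>1, \<dots>, s\<^sub>m])\<close>, so the list entry
  \<open>ss ! i\<close> is \<open>s\<^sub>\<nu>\<close> with \<open>\<nu> = i + 1\<close>.\<close>

definition Psi_irr_hat :: "nat \<Rightarrow> (nat \<times> nat list) set" where
  "Psi_irr_hat m = {(p, ss). length ss = m \<and> (\<forall>i<m. ss ! i < p) \<and>
                             even (ss ! 0) \<and> 2 \<le> ss ! 0 \<and> ss ! 0 \<le> p - 3 \<and>
                             (p, \<Sum>i<m. ss ! i * totient (p ^ i)) \<in> Psi_irr m}"

text \<open>The level \<open>m\<close> of the pair \<open>(p, l) \<in> Psi_irr m\<close>, on which the value depends, is an explicit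
  argument.\<close>

definition Delta :: "nat \<Rightarrow> nat \<Rightarrow> nat \<Rightarrow> nat" where
  "Delta m p l = (THE d. d < p \<and>
     ppow_dvd p 1 (of_nat d -
       (bernoulli (l + totient (p ^ m)) / of_nat (l + totient (p ^ m)) - bernoulli l / of_nat l)
         / of_nat p ^ m))"

text \<open>The p-adic integers as the inverse limit of the rings of integers modulo \<open>p ^ k\<close>: the
  \<open>k\<close>-th component of an element is its least nonnegative residue modulo \<open>p ^ k\<close>. Thus
  \<open>p ^ k\<close> divides \<open>x\<close> iff \<open>x k = 0\<close>, and a sequence converges p-adically iff each of its
  components is eventually constant.\<close>

definition padic_ints :: "nat \<Rightarrow> (nat \<Rightarrow> int) set" where
  "padic_ints p = {x. \<forall>k. 0 \<le> x k \<and> x k < int p ^ k \<and> x (Suc k) mod int p ^ k = x k}"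

definition padic_of_int :: "nat \<Rightarrow> int \<Rightarrow> nat \<Rightarrow> int" where
  "padic_of_int p a = (\<lambda>k. a mod int p ^ k)"

definition padic_minus :: "nat \<Rightarrow> (nat \<Rightarrow> int) \<Rightarrow> (nat \<Rightarrow> int) \<Rightarrow> nat \<Rightarrow> int" where
  "padic_minus p x y = (\<lambda>k. (x k - y k) mod int p ^ k)"

definition padic_ord :: "(nat \<Rightarrow> int) \<Rightarrow> enat" where
  "padic_ord x = Sup {enat k |k. x k = 0}"

text \<open>The p-adic sum of a convergent series of integers.\<close>

definition padic_suminf :: "nat \<Rightarrow> (nat \<Rightarrow> int) \<Rightarrow> nat \<Rightarrow> int" where
  "padic_suminf p f = (THE x. x \<in> padic_ints p \<and>
     (\<forall>k. \<forall>\<^sub>F N in sequentially. padic_of_int p (\<Sum>\<nu><N. f \<nu>) k = x k))"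

text \<open>The sequence \<open>(s\<^sub>\<nu>)\<close> with \<open>\<nu> \<ge> 1\<close> is stored with its index shifted by one, as in
  \<^const>\<open>Psi_irr_hat\<close>.\<close>

definition chi_digits :: "nat \<Rightarrow> nat \<Rightarrow> nat \<Rightarrow> nat" where
  "chi_digits p l = (THE s. s 0 = l \<and> (\<forall>m\<ge>1. (p, map s [0..<m]) \<in> Psi_irr_hat m))"

definition chi :: "nat \<Rightarrow> nat \<Rightarrow> nat \<Rightarrow> int" where
  "chi p l = padic_suminf p (\<lambda>\<nu>. int (chi_digits p l (\<nu> + 1)) * int p ^ \<nu>)"

text \<open>A node \<open>(p, l')\<close> of height \<open>r\<close> is the pair \<open>(r, l')\<close>. The height has to be recorded: the
  child with \<open>j = 0\<close> carries the same label as its parent. Within one height the label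
  determines the node.\<close>

inductive_set T0_nodes :: "nat \<Rightarrow> nat \<Rightarrow> (nat \<times> nat) set" for p l :: nat where
  root: "(0, l) \<in> T0_nodes p l"
| child: "(r, l') \<in> T0_nodes p l \<Longrightarrow> (p, l') \<in> Psi_irr (r + 2) \<Longrightarrow> j < p \<Longrightarrow>
    (r + 1, l' + j * totient (p ^ (r + 1))) \<in> T0_nodes p l"

text \<open>Labels at height \<open>r\<close> are residues modulo \<open>totient (p ^ (r + 1))\<close>, so the modulus that a node
  is tested against is \<open>totient (p ^ \<nu>)\<close> with \<open>\<nu> = r + 1\<close>. Leaving \<open>\<nu>\<close> unrelated to the height
  would also admit the \<open>j = 0\<close> descendants of a node, which share its label but in general
  are not residues of \<open>n\<close> at their own height. The supremum is the maximum when the set is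
  finite and \<open>\<infinity>\<close> otherwise.\<close>

definition h0 :: "nat \<Rightarrow> nat \<Rightarrow> enat" where
  "h0 p n = Sup {enat r |r. (r, n mod totient (p ^ (r + 1))) \<in> T0_nodes p (n mod (p - 1))}"

end

theory Submission
  imports Defs
begin

text \<open>Write \<open>G(n) = (1 - p^(n-1)) B\<^sub>n / n\<close>. By Voronoi's congruence \<open>(c^n - 1) G(n)\<close> is the p-adic limit of
  the sums of \<open>(j c)^(n-1)\<close> over the units \<open>j\<close> modulo \<open>p^M\<close>, weighted by the integer parts of \<open>j c / p^M\<close>.
  Along \<open>n = l + (p-1) s\<close> these sums inherit the expansion of
  \<open>a^((p-1) p^k t) = (1 + p q)^(p^k t)\<close> modulo \<open>p^(k+2)\<close>: the value \<open>G(n)\<close> modulo \<open>p^(k+1)\<close>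
  depends only on \<open>s\<close> modulo \<open>p^k\<close>, and if \<open>p\<close> divides \<open>G(l)\<close>, then \<open>G(n)\<close> is affine in \<open>s\<close> modulo
  \<open>p^(k+2)\<close> on such a class, with slope \<open>p \<Delta>\<close> for every \<open>k\<close>. If \<open>\<Delta> \<noteq> 0\<close>, then \<open>G / p\<close> is a p-adic isometry
  in \<open>s\<close> and has a unique zero, which is \<open>\<chi>\<close>. If \<open>\<Delta> = 0\<close>, then divisibility by \<open>p^(k+2)\<close> depends only
  on \<open>s\<close> modulo \<open>p^k\<close>, which is the branching rule of the tree. Finally \<open>p\<close> dividing \<open>n\<close> forces
  \<open>s \<equiv> l\<close> modulo \<open>p\<close>, so that \<open>G(n)\<close> and \<open>G(l p)\<close> agree modulo \<open>p^2\<close>.\<close>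

section \<open>Divisibility in the localization of the integers at p\<close>

text \<open>All fractions representing \<open>x\<close> have the same difference of multiplicities,
  so the reduced fraction in \<open>rat_ord\<close> can be traded for any fraction whose denominator
  is prime to \<open>p\<close>. The closure lemmas compute with such fractions; \<open>a = 0\<close>
  covers \<open>x = 0\<close>.\<close>

lemma ppow_dvd_iff:
  assumes p: "prime p"
  shows "ppow_dvd p k x \<longleftrightarrow>
    (\<exists>a b. \<not> int p dvd b \<and> x = of_int (int p ^ k * a) / of_int b)"
proof -
  have pp: "prime (int p)" using p by simp
  hence ip: "\<not> is_unit (int p)" using not_prime_unit by blast
  obtain u v where q: "quotient_of x = (u, v)" by force
  have v: "v > 0" using quotient_of_denom_pos[OF q] .
  have xq: "x = of_int u / of_int v" using quotient_of_div[OF q] .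
  have cop: "coprime u v" using quotient_of_coprime[OF q] .
  show ?thesis
  proof (cases "x = 0")
    case True
    have "\<not> int p dvd 1" using ip by simp
    moreover have "x = of_int (int p ^ k * 0) / of_int 1" using True by simp
    ultimately show ?thesis using True unfolding ppow_dvd_def by blast
  next
    case False
    hence u0: "u \<noteq> 0" using xq by auto
    have ord: "rat_ord p x = int (multiplicity (int p) u) - int (multiplicity (int p) v)"
      by (simp add: rat_ord_def q)
    have *: "int (multiplicity (int p) a') - int (multiplicity (int p) b') = rat_ord p x"
      if "x = of_int a' / of_int b'" "a' \<noteq> 0" "b' \<noteq> 0" for a' b'
    proof -
      have "(of_int (a' * v) :: rat) = of_int (u * b')"
        using that xq v by (simp add: field_simps)
      hence "a' * v = u * b'" by (simp only: of_int_eq_iff)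
      hence "multiplicity (int p) (a' * v) = multiplicity (int p) (u * b')" by simp
      hence "multiplicity (int p) a' + multiplicity (int p) v =
          multiplicity (int p) u + multiplicity (int p) b'"
        using that u0 v pp by (simp add: prime_elem_multiplicity_mult_distrib)
      thus ?thesis unfolding ord by linarith
    qed
    show ?thesis
    proof
      assume "ppow_dvd p k x"
      hence ge: "int (multiplicity (int p) u) \<ge> int k + int (multiplicity (int p) v)"
        using False ord unfolding ppow_dvd_def by simp
      have dvd: "int p dvd w" if "multiplicity (int p) w > 0" for w
        using that not_dvd_imp_multiplicity_0 by fastforce
      \<comment> \<open>A factor \<open>p\<close> of the denominator would force one in the
        numerator, against coprimality.\<close>
      have "\<not> int p dvd v"
      proof
        assume a: "int p dvd v"
        hence "multiplicity (int p) v > 0"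
          using v ip by (simp add: multiplicity_gt_zero_iff)
        hence "int p dvd u" using ge dvd by simp
        thus False using a cop ip not_coprimeI by blast
      qed
      moreover have "int p ^ k dvd u"
        using ge by (intro multiplicity_dvd') simp
      then obtain a where "u = int p ^ k * a" ..
      ultimately show "\<exists>a b. \<not> int p dvd b \<and> x = of_int (int p ^ k * a) / of_int b"
        using xq by blast
    next
      assume "\<exists>a b. \<not> int p dvd b \<and> x = of_int (int p ^ k * a) / of_int b"
      then obtain a b where b: "\<not> int p dvd b" and x: "x = of_int (int p ^ k * a) / of_int b"
        by blast
      have "int p ^ k * a \<noteq> 0" "b \<noteq> 0" using False x b by auto
      moreover have "multiplicity (int p) (int p ^ k * a) \<ge> k"
        using calculation ip by (intro multiplicity_geI) auto
      ultimately have "rat_ord p x \<ge> int k"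
        using *[OF x] not_dvd_imp_multiplicity_0[OF b] by simp
      thus "ppow_dvd p k x" by (simp add: ppow_dvd_def)
    qed
  qed
qed

lemma ppow_dvd_0 [simp]: "ppow_dvd p k 0"
  by (simp add: ppow_dvd_def)

lemma ppow_dvd_mono: "ppow_dvd p k x \<Longrightarrow> j \<le> k \<Longrightarrow> ppow_dvd p j x"
  by (auto simp: ppow_dvd_def)

lemma ppow_exact_iff: "ppow_exact p k x \<longleftrightarrow> ppow_dvd p k x \<and> \<not> ppow_dvd p (Suc k) x"
  by (auto simp: ppow_dvd_def ppow_exact_def)

lemma ppow_exact_dvd_iff: "ppow_exact p k x \<Longrightarrow> ppow_dvd p j x \<longleftrightarrow> j \<le> k"
  by (auto simp: ppow_dvd_def ppow_exact_def)

lemma ppow_exact_exists: "x \<noteq> 0 \<Longrightarrow> ppow_dvd p 0 x \<Longrightarrow> \<exists>k. ppow_exact p k x"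
  by (intro exI[of _ "nat (rat_ord p x)"]) (auto simp: ppow_dvd_def ppow_exact_def)

lemma ppow_dvd_minus:
  assumes "prime p" "ppow_dvd p k x"
  shows "ppow_dvd p k (- x)"
proof -
  obtain a b where "\<not> int p dvd b" "x = of_int (int p ^ k * a) / of_int b"
    using assms ppow_dvd_iff by blast
  hence "\<not> int p dvd b \<and> - x = of_int (int p ^ k * (- a)) / of_int b" by simp
  thus ?thesis using ppow_dvd_iff[OF assms(1)] by blast
qed

lemma ppow_dvd_add:
  assumes p: "prime p" and "ppow_dvd p k x" "ppow_dvd p k y"
  shows "ppow_dvd p k (x + y)"
proof -
  obtain a b c d where b: "\<not> int p dvd b" and x: "x = of_int (int p ^ k * a) / of_int b"
    and d: "\<not> int p dvd d" and y: "y = of_int (int p ^ k * c) / of_int d"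
    using assms ppow_dvd_iff by metis
  have "b \<noteq> 0" "d \<noteq> 0" using b d by auto
  hence "x + y = of_int (int p ^ k * (a * d + c * b)) / of_int (b * d)"
    by (simp add: x y field_simps)
  moreover have "\<not> int p dvd b * d"
    using b d p by (simp add: prime_dvd_mult_iff)
  ultimately show ?thesis using ppow_dvd_iff[OF p] by blast
qed

lemma ppow_dvd_diff:
  "prime p \<Longrightarrow> ppow_dvd p k x \<Longrightarrow> ppow_dvd p k y \<Longrightarrow> ppow_dvd p k (x - y)"
  using ppow_dvd_add[of p k x "- y"] ppow_dvd_minus[of p k y] by simp

lemma ppow_dvd_mult:
  assumes p: "prime p" and "ppow_dvd p j x" "ppow_dvd p k y"
  shows "ppow_dvd p (j + k) (x * y)"
proof -
  obtain a b c d where b: "\<not> int p dvd b" and x: "x = of_int (int p ^ j * a) / of_int b"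
    and d: "\<not> int p dvd d" and y: "y = of_int (int p ^ k * c) / of_int d"
    using assms ppow_dvd_iff by metis
  have "x * y = of_int (int p ^ (j + k) * (a * c)) / of_int (b * d)"
    by (simp add: x y power_add)
  moreover have "\<not> int p dvd b * d"
    using b d p by (simp add: prime_dvd_mult_iff)
  ultimately show ?thesis using ppow_dvd_iff[OF p] by blast
qed

lemma ppow_dvd_of_int_iff:
  assumes p: "prime p"
  shows "ppow_dvd p k (of_int a) \<longleftrightarrow> int p ^ k dvd a"
proof
  assume "int p ^ k dvd a"
  then obtain c where "a = int p ^ k * c" ..
  hence "\<not> int p dvd 1 \<and> (of_int a :: rat) = of_int (int p ^ k * c) / of_int 1"
    using p prime_gt_1_nat[OF p] by simp
  thus "ppow_dvd p k (of_int a)" using ppow_dvd_iff[OF p] by blast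
next
  assume "ppow_dvd p k (of_int a)"
  then obtain c b where b: "\<not> int p dvd b" and x: "(of_int a :: rat) = of_int (int p ^ k * c) / of_int b"
    using ppow_dvd_iff[OF p] by blast
  have "b \<noteq> 0" using b by auto
  hence "(of_int (a * b) :: rat) = of_int (int p ^ k * c)" using x by (simp add: field_simps)
  hence "a * b = int p ^ k * c" by (simp only: of_int_eq_iff)
  hence "int p ^ k dvd a * b" by simp
  moreover have "coprime (int p ^ k) b"
    using b p by (simp add: prime_imp_coprime)
  ultimately show "int p ^ k dvd a"
    using coprime_dvd_mult_left_iff by blast
qed

lemma ppow_dvd_of_nat_iff: "prime p \<Longrightarrow> ppow_dvd p k (of_nat a) \<longleftrightarrow> p ^ k dvd a"
  using ppow_dvd_of_int_iff[of p k "int a"] by (simp flip: of_nat_power)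

lemma ppow_dvd_int_mult: "prime p \<Longrightarrow> ppow_dvd p k x \<Longrightarrow> ppow_dvd p k (of_int a * x)"
  using ppow_dvd_mult[of p 0 "of_int a" k x] by (simp add: ppow_dvd_of_int_iff)

lemma ppow_dvd_unit_mult_iff:
  assumes p: "prime p" and u: "\<not> int p dvd u"
  shows "ppow_dvd p k (of_int u * x) \<longleftrightarrow> ppow_dvd p k x"
proof
  assume "ppow_dvd p k (of_int u * x)"
  then obtain c b where b: "\<not> int p dvd b" and x: "of_int u * x = of_int (int p ^ k * c) / of_int b"
    using ppow_dvd_iff[OF p] by blast
  have "u \<noteq> 0" using u by auto
  hence "of_int u * x = of_int u * (of_int (int p ^ k * c) / of_int (u * b))"
    using x by simp
  hence "x = of_int (int p ^ k * c) / of_int (u * b)"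
    by (rule mult_left_cancel[THEN iffD1, rotated]) (use \<open>u \<noteq> 0\<close> in simp)
  moreover have "\<not> int p dvd u * b"
    using b u p by (simp add: prime_dvd_mult_iff)
  ultimately show "ppow_dvd p k x" using ppow_dvd_iff[OF p] by blast
qed (simp add: ppow_dvd_int_mult p)

lemma ppow_dvd_prime_power_mult_iff:
  assumes p: "prime p"
  shows "ppow_dvd p (j + k) (of_nat p ^ j * x) \<longleftrightarrow> ppow_dvd p k x"
proof
  have p0: "p \<noteq> 0" using p by auto
  assume "ppow_dvd p (j + k) (of_nat p ^ j * x)"
  then obtain c b where b: "\<not> int p dvd b"
    and x: "of_nat p ^ j * x = of_int (int p ^ (j + k) * c) / of_int b"
    using ppow_dvd_iff[OF p] by blast
  have "of_nat p ^ j * x = of_nat p ^ j * (of_int (int p ^ k * c) / of_int b)"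
    using x by (simp add: power_add)
  hence "x = of_int (int p ^ k * c) / of_int b"
    by (rule mult_left_cancel[THEN iffD1, rotated]) (use p0 in simp)
  thus "ppow_dvd p k x" using b ppow_dvd_iff[OF p] by blast
next
  assume "ppow_dvd p k x"
  moreover have "ppow_dvd p j (of_nat p ^ j)"
    using ppow_dvd_of_nat_iff[OF p, of j "p ^ j"] by simp
  ultimately show "ppow_dvd p (j + k) (of_nat p ^ j * x)"
    using ppow_dvd_mult p by blast
qed

lemma ppow_exactE:
  assumes p: "prime p" and x: "ppow_exact p k x"
  obtains a b where "\<not> int p dvd a" "\<not> int p dvd b" "of_int b * x = of_int (int p ^ k * a)"
proof -
  obtain a b where b: "\<not> int p dvd b" and x': "x = of_int (int p ^ k * a) / of_int b"
    using x ppow_dvd_iff[OF p] unfolding ppow_exact_iff by blast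
  have "b \<noteq> 0" using b by auto
  hence bx: "of_int b * x = of_int (int p ^ k * a)" using x' by simp
  have "\<not> ppow_dvd p (Suc k) (of_int b * x)"
    using x by (simp add: ppow_exact_iff ppow_dvd_unit_mult_iff[OF p b])
  hence "\<not> int p ^ Suc k dvd int p ^ k * a"
    unfolding bx ppow_dvd_of_int_iff[OF p] .
  hence "\<not> int p dvd a"
    using prime_gt_0_nat[OF p] by auto
  thus ?thesis using b bx that by blast
qed

text \<open>Parts prime to \<open>p\<close> multiply to a part prime to \<open>p\<close>. This
  separates \<open>r\<close> from \<delta> in the order of \<open>B_n\<close>.\<close>

lemma ppow_exact_mult:
  assumes p: "prime p" and x: "ppow_exact p j x" and y: "ppow_exact p k y"
  shows "ppow_exact p (j + k) (x * y)"
proof -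
  obtain a b where a: "\<not> int p dvd a" and b: "\<not> int p dvd b"
    and bx: "of_int b * x = of_int (int p ^ j * a)"
    using ppow_exactE[OF p x] by blast
  obtain c d where c: "\<not> int p dvd c" and d: "\<not> int p dvd d"
    and dy: "of_int d * y = of_int (int p ^ k * c)"
    using ppow_exactE[OF p y] by blast
  have bd: "\<not> int p dvd b * d" using b d p by (simp add: prime_dvd_mult_iff)
  have "of_int (b * d) * (x * y) = (of_int b * x) * (of_int d * y)" by simp
  hence eq: "of_int (b * d) * (x * y) = of_int (int p ^ (j + k) * (a * c))"
    unfolding bx dy by (simp add: power_add)
  have "ppow_dvd p i (x * y) \<longleftrightarrow> int p ^ i dvd int p ^ (j + k) * (a * c)" for i
    unfolding ppow_dvd_unit_mult_iff[OF p bd, of i "x * y", symmetric] eq ppow_dvd_of_int_iff[OF p] ..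
  moreover have "\<not> int p dvd a * c" using a c p by (simp add: prime_dvd_mult_iff)
  ultimately show ?thesis
    using p by (auto simp: ppow_exact_iff)
qed

lemma ppow_dvd_divide_exact:
  assumes p: "prime p" and e: "ppow_exact p j e" and x: "ppow_dvd p (j + k) x"
  shows "ppow_dvd p k (x / e)"
proof -
  obtain a b where a: "\<not> int p dvd a" and be: "of_int b * e = of_int (int p ^ j * a)"
    using ppow_exactE[OF p e] by blast
  have "e \<noteq> 0" using e by (auto simp: ppow_exact_def)
  have "of_nat p ^ j * (of_int a * (x / e)) = of_int (int p ^ j * a) * (x / e)" by simp
  also have "\<dots> = of_int b * e * (x / e)" by (simp only: be)
  also have "\<dots> = of_int b * x" using \<open>e \<noteq> 0\<close> by simp
  finally have "ppow_dvd p (j + k) (of_nat p ^ j * (of_int a * (x / e)))"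
    using ppow_dvd_int_mult[OF p x] by simp
  thus ?thesis
    by (simp only: ppow_dvd_prime_power_mult_iff[OF p] ppow_dvd_unit_mult_iff[OF p a])
qed

text \<open>The power of \<open>p\<close> in the reduced denominator suffices. This replaces any
  knowledge about the denominators of Bernoulli numbers.\<close>

lemma ppow_dvd_clear_denominator:
  assumes p: "prime p"
  shows "\<exists>C. ppow_dvd p 0 (of_nat p ^ C * x)"
proof -
  obtain u v where q: "quotient_of x = (u, v)" by force
  have v: "v > 0" using quotient_of_denom_pos[OF q] .
  have xq: "x = of_int u / of_int v" using quotient_of_div[OF q] .
  have ip: "\<not> is_unit (int p)" using p not_prime_unit by auto
  obtain b where b: "v = int p ^ multiplicity (int p) v * b" "\<not> int p dvd b"
    using multiplicity_decompose'[of v "int p"] v ip by (metis less_irrefl)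
  have "of_nat p ^ multiplicity (int p) v * x = of_int (int p ^ 0 * u) / of_int b"
    using p prime_gt_0_nat[OF p] v xq
    by (subst xq, subst b(1)) (auto simp: field_simps)
  thus ?thesis using b ppow_dvd_iff[OF p] by blast
qed

text \<open>The residue field of the localization has \<open>p\<close> elements. Uniqueness makes
  the description in \<open>Delta\<close> meaningful; existence supplies the next digit in
  \<open>exists_root\<close>.\<close>

lemma ppow_dvd_residue_unique:
  assumes p: "prime p" and x: "ppow_dvd p 0 x"
  shows "\<exists>!d::nat. d < p \<and> ppow_dvd p 1 (of_nat d - x)"
proof -
  obtain a b where b: "\<not> int p dvd b" and xx: "x = of_int (int p ^ 0 * a) / of_int b"
    using x ppow_dvd_iff[OF p] by blast
  have b0: "b \<noteq> 0" using b by auto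
  have p0: "int p > 0" using prime_gt_0_nat[OF p] by simp
  have eq: "ppow_dvd p 1 (of_nat d - x) \<longleftrightarrow> [b * int d = a] (mod int p)" for d
  proof -
    have "of_int b * (of_nat d - x) = of_int (b * int d - a)"
      using b0 by (simp add: xx field_simps)
    thus ?thesis
      using ppow_dvd_unit_mult_iff[OF p b, of 1 "of_nat d - x"]
        ppow_dvd_of_int_iff[OF p, of 1 "b * int d - a"] by (simp add: cong_iff_dvd_diff)
  qed
  have cop: "coprime b (int p)"
    using b p prime_imp_coprime[of "int p" b] by (simp add: coprime_commute)
  then obtain y where y: "[b * y = 1] (mod int p)" using cong_solve_coprime_int by blast
  define d where "d = nat (y * a mod int p)"
  have di: "int d = y * a mod int p" unfolding d_def using p0 by simp
  have "[b * int d = a] (mod int p)"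
    using cong_scalar_right[OF y, of a] by (simp add: di cong_def mod_mult_right_eq mult.assoc)
  moreover have "d < p" using di p0 by (metis of_nat_less_iff pos_mod_bound)
  ultimately show ?thesis
  proof (intro ex1I[of _ d])
    fix e assume e: "e < p \<and> ppow_dvd p 1 (of_nat e - x)"
    hence "[b * int e = b * int d] (mod int p)"
      using \<open>[b * int d = a] (mod int p)\<close> eq cong_sym cong_trans by blast
    hence "[int e = int d] (mod int p)" using cop cong_mult_lcancel by blast
    thus "e = d" using e \<open>d < p\<close> by (metis cong_int_iff cong_less_modulus_unique_nat)
  qed (use eq in auto)
qed

section \<open>Bernoulli numbers\<close>

definition bernoulli_fps :: "rat fps" where
  "bernoulli_fps = fps_X / (fps_exp 1 - 1)"

lemma bernoulli_eq: "bernoulli n = fact n * fps_nth bernoulli_fps n"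
  by (simp add: bernoulli_def bernoulli_fps_def)

text \<open>The division is exact because \<open>fps_exp 1 - 1\<close> has subdegree 1 and hence
  divides \<open>fps_X\<close>.\<close>

lemma bernoulli_fps_mult: "bernoulli_fps * (fps_exp 1 - 1) = fps_X"
proof -
  have *: "subdegree (fps_exp 1 - 1 :: rat fps) = 1"
    by (rule subdegreeI) auto
  hence "fps_exp 1 - (1 :: rat fps) \<noteq> 0" by auto
  hence "fps_exp 1 - (1 :: rat fps) dvd fps_X"
    using * by (subst fps_dvd_iff) auto
  thus ?thesis unfolding bernoulli_fps_def by simp
qed

text \<open>Differentiating the product relation and multiplying by \<open>bernoulli_fps\<close>
  eliminates the exponential.\<close>

lemma bernoulli_fps_deriv:
  "fps_X * fps_deriv bernoulli_fps = bernoulli_fps - fps_X * bernoulli_fps - bernoulli_fps ^ 2"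
proof -
  have "fps_deriv (bernoulli_fps * (fps_exp 1 - 1)) = fps_deriv fps_X"
    by (simp only: bernoulli_fps_mult)
  hence *: "fps_deriv bernoulli_fps * (fps_exp 1 - 1) + bernoulli_fps * fps_exp 1 = 1"
    by (simp add: algebra_simps)
  have "fps_X * fps_deriv bernoulli_fps =
      bernoulli_fps * (fps_deriv bernoulli_fps * (fps_exp 1 - 1))"
    by (simp only: bernoulli_fps_mult[symmetric] mult_ac)
  also have "fps_deriv bernoulli_fps * (fps_exp 1 - 1) = 1 - bernoulli_fps * fps_exp 1"
    using * by (simp only: eq_diff_eq)
  also have "bernoulli_fps * (1 - bernoulli_fps * fps_exp 1) = bernoulli_fps - bernoulli_fps * (bernoulli_fps * (fps_exp 1 - 1)) - bernoulli_fps ^ 2"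
    by (simp add: power2_eq_square algebra_simps)
  finally show ?thesis by (simp add: bernoulli_fps_mult mult.commute)
qed

text \<open>Adding \<open>z / 2\<close> kills the odd coefficients and turns the differential equation of
  \<open>z / (e^z - 1)\<close> into the quadratic recurrence from which the signs can be read off.\<close>

lemma even_bernoulli_fps_square:
  fixes g :: "rat fps"
  defines "g \<equiv> bernoulli_fps + fps_const (1/2) * fps_X"
  shows "g ^ 2 = g - fps_X * fps_deriv g + fps_const (1/4) * fps_X ^ 2"
proof -
  define h :: "rat fps" where "h = fps_const (1/2)"
  have c: "fps_const (1/4) = h * h" and d: "h + h = 1"
    by (simp_all add: h_def fps_eq_iff)
  have "fps_X * fps_deriv g = fps_X * fps_deriv bernoulli_fps + h * fps_X"
    by (simp add: g_def h_def algebra_simps)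
  moreover have "g ^ 2 = bernoulli_fps ^ 2 + (h + h) * (fps_X * bernoulli_fps) + h * h * fps_X ^ 2"
    unfolding g_def h_def[symmetric] by (simp add: power2_eq_square algebra_simps)
  ultimately show ?thesis
    unfolding c d bernoulli_fps_deriv by (simp add: g_def h_def)
qed

text \<open>Coefficient \<open>n\<close> of the quadratic identity expresses
  \<open>- (n + 1) * b n\<close> by the products \<open>b i * b (n - i)\<close> with
  \<open>0 < i < n\<close>, apart from a constant at \<open>n = 2\<close>. For odd \<open>n\<close>
  every product has a factor of odd index; for even \<open>n\<close> the nonzero products share one
  sign, so nothing cancels.\<close>

lemma bernoulli_sign:
  fixes b :: "nat \<Rightarrow> rat"
  defines "b \<equiv> fps_nth (bernoulli_fps + fps_const (1/2) * fps_X)"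
  assumes "n > 0"
  shows "(odd n \<longrightarrow> b n = 0) \<and> (even n \<longrightarrow> (- 1) ^ (n div 2 + 1) * b n > 0)"
proof -
  define g where "g = bernoulli_fps + fps_const (1/2) * fps_X"
  have bg: "b = fps_nth g" by (simp add: b_def g_def)
  have "fps_nth (bernoulli_fps * (fps_exp 1 - 1)) 1 = 1"
    by (subst bernoulli_fps_mult) simp
  hence b0: "b 0 = 1" by (simp add: fps_mult_nth bg g_def)
  have rec: "(\<Sum>i=0..m. b i * b (m - i)) = b m - of_nat m * b m + (if m = 2 then 1/4 else 0)"
    for m
  proof -
    have "(\<Sum>i=0..m. b i * b (m - i)) = fps_nth (g ^ 2) m"
      by (simp only: power2_eq_square fps_mult_nth bg)
    also have "\<dots> = fps_nth (g - fps_X * fps_deriv g + fps_const (1/4) * fps_X ^ 2) m"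
      using even_bernoulli_fps_square unfolding g_def by simp
    also have "\<dots> = b m - of_nat m * b m + (if m = 2 then 1/4 else 0)"
      by (cases m) (auto simp: bg fps_X_power_nth)
    finally show ?thesis .
  qed
  have rec': "(\<Sum>i\<in>{1..<m}. b i * b (m - i)) = - (of_nat m + 1) * b m + (if m = 2 then 1/4 else 0)"
    if "m > 0" for m
  proof -
    have "{0..m} = insert 0 (insert m {1..<m})" using that by auto
    thus ?thesis using rec[of m] that by (simp add: b0 algebra_simps)
  qed
  show ?thesis using \<open>n > 0\<close>
  proof (induction n rule: less_induct)
    case (less n)
    show ?case
    proof (cases "even n")
      case False
      have "(\<Sum>i\<in>{1..<n}. b i * b (n - i)) = 0"
      proof (intro sum.neutral ballI)
        fix i assume i: "i \<in> {1..<n}"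
        hence "odd i \<or> odd (n - i)" using False by auto
        thus "b i * b (n - i) = 0" using less.IH[of i] less.IH[of "n - i"] i by auto
      qed
      moreover have "n \<noteq> 2" using False by auto
      ultimately have "(of_nat n + 1) * b n = 0" using rec'[of n] less.prems by (simp add: algebra_simps)
      moreover have "(of_nat n + 1 :: rat) \<noteq> 0"
        by (metis of_nat_1 of_nat_add of_nat_eq_0_iff add_is_0 zero_neq_one)
      ultimately show ?thesis using False by simp
    next
      case True
      show ?thesis
      proof (cases "n = 2")
        case True
        \<comment> \<open>At \<open>n = 2\<close> the sum is zero, and the constant 1/4 starts the
          alternation of signs.\<close>
        have "b 1 = 0" using rec'[of 1] by simp
        moreover have "{1..<2::nat} = {1}" by auto
        ultimately have "b 2 > 0" using rec'[of 2] by simp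
        thus ?thesis by (simp add: True)
      next
        case False
        have n4: "n \<ge> 4" using False True less.prems by presburger
        have nonneg: "(- 1) ^ (n div 2) * (b i * b (n - i)) \<ge> 0"
          and pos: "even i \<Longrightarrow> (- 1) ^ (n div 2) * (b i * b (n - i)) > 0"
          if i: "i \<in> {1..<n}" for i
        proof -
          show *: "(- 1) ^ (n div 2) * (b i * b (n - i)) > 0" if ev: "even i"
          proof -
            obtain a where a: "i = 2 * a" using ev by blast
            obtain m where m: "n = 2 * m" using \<open>even n\<close> by blast
            have d: "n - i = 2 * (m - a)" "n div 2 = i div 2 + (n - i) div 2"
              using i by (simp add: a m diff_mult_distrib2) (use i in \<open>simp add: a m flip: diff_mult_distrib2\<close>)
            have "(- 1) ^ (i div 2 + 1) * b i > 0"
              using less.IH[of i] i ev by simp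
            moreover have "n - i < n" "n - i > 0" "even (n - i)" using i d(1) by auto
            hence "(- 1) ^ ((n - i) div 2 + 1) * b (n - i) > 0"
              using less.IH[of "n - i"] by blast
            ultimately
            have "0 < ((- 1) ^ (i div 2 + 1) * b i) * ((- 1) ^ ((n - i) div 2 + 1) * b (n - i))"
              by (rule mult_pos_pos)
            also have "\<dots> = (- 1) ^ (n div 2) * (b i * b (n - i))"
              unfolding d(2) by (simp add: power_add)
            finally show ?thesis .
          qed
          show "(- 1) ^ (n div 2) * (b i * b (n - i)) \<ge> 0"
            using * less.IH[of i] i by (cases "even i") (simp_all add: less_imp_le)
        qed
        \<comment> \<open>The term \<open>i = 2\<close> is strictly positive, and it is in range
          since \<open>n\<close> is at least 4.\<close>
        have "(\<Sum>i\<in>{1..<n}. (- 1) ^ (n div 2) * (b i * b (n - i))) > 0"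
          using n4 nonneg pos by (intro sum_pos2[of _ 2]) auto
        also have "(\<Sum>i\<in>{1..<n}. (- 1) ^ (n div 2) * (b i * b (n - i))) =
            (- 1) ^ (n div 2) * (- (of_nat n + 1) * b n)"
          using rec'[of n] less.prems False by (simp only: sum_distrib_left[symmetric]) simp
        finally have "(of_nat n + 1) * ((- 1) ^ (n div 2 + 1) * b n) > 0"
          by (simp add: algebra_simps)
        hence "(- 1) ^ (n div 2 + 1) * b n > 0"
          by (rule zero_less_mult_pos) simp
        thus ?thesis using \<open>even n\<close> by simp
      qed
    qed
  qed
qed

lemma bernoulli_nonzero:
  assumes "even n" "n > 0"
  shows "bernoulli n \<noteq> 0"
proof -
  \<comment> \<open>The series in \<open>bernoulli_sign\<close> differs from the generating function
    only in the coefficient of index 1.\<close>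
  have "n \<noteq> 1" using assms by auto
  thus ?thesis using bernoulli_sign[OF assms(2)] assms by (auto simp: bernoulli_eq)
qed

text \<open>Compare coefficients of index \<open>n + 1\<close> after multiplying the geometric sum
  of the \<open>fps_exp (of_nat j)\<close> by \<open>fps_X\<close>. The part linear in
  \<open>N\<close> is split off; in the rest the rational coefficients do not involve
  \<open>N\<close>, so their denominators can be bounded for all \<open>N = p ^ M\<close> at
  once.\<close>

lemma power_sum_bernoulli:
  "(\<Sum>j<N. of_nat j ^ n) =
     of_nat N * bernoulli n +
     of_nat N ^ 2 * (\<Sum>i<n. of_nat (N ^ (n - 1 - i)) * (fact n * fps_nth bernoulli_fps i / fact (n + 1 - i)))"
proof -
  have "(fps_exp 1 - 1) * (\<Sum>j<N. fps_exp (of_nat j)) = (fps_exp (of_nat N) - 1 :: rat fps)"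
    using power_diff_1_eq[of "fps_exp 1 :: rat fps" N] by (simp add: fps_exp_power_mult)
  hence "fps_X * (\<Sum>j<N. fps_exp (of_nat j)) = bernoulli_fps * (fps_exp (of_nat N) - 1)"
    using bernoulli_fps_mult by (metis mult.assoc)
  hence "fps_nth (fps_X * (\<Sum>j<N. fps_exp (of_nat j))) (Suc n) =
      fps_nth (bernoulli_fps * (fps_exp (of_nat N) - 1)) (Suc n)" by simp
  hence "(\<Sum>j<N. of_nat j ^ n / fact n) =
      (\<Sum>i=0..Suc n. fps_nth bernoulli_fps i * fps_nth (fps_exp (of_nat N) - 1) (Suc n - i))"
    by (simp only: fps_X_mult_nth fps_sum_nth fps_mult_nth[of bernoulli_fps]) simp
  also have "\<dots> = (\<Sum>i=0..n. fps_nth bernoulli_fps i * fps_nth (fps_exp (of_nat N) - 1) (Suc n - i))"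
    by simp
  also have "\<dots> = (\<Sum>i\<le>n. fps_nth bernoulli_fps i * (of_nat N ^ (n + 1 - i) / fact (n + 1 - i)))"
    unfolding atMost_atLeast0 by (intro sum.cong refl) (auto simp: Suc_diff_le simp del: fact_Suc)
  finally have "(\<Sum>j<N. of_nat j ^ n) =
     fact n * (\<Sum>i\<le>n. fps_nth bernoulli_fps i * (of_nat N ^ (n + 1 - i) / fact (n + 1 - i)))"
    by (simp flip: sum_divide_distrib add: divide_eq_eq mult.commute)
  also have "\<dots> = fact n * (\<Sum>i<n. fps_nth bernoulli_fps i * (of_nat N ^ (n + 1 - i) / fact (n + 1 - i))) + of_nat N * bernoulli n"
    by (simp add: lessThan_Suc_atMost[symmetric] bernoulli_eq algebra_simps)
  also have "fact n * (\<Sum>i<n. fps_nth bernoulli_fps i * (of_nat N ^ (n + 1 - i) / fact (n + 1 - i))) =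
     of_nat N ^ 2 * (\<Sum>i<n. of_nat (N ^ (n - 1 - i)) * (fact n * fps_nth bernoulli_fps i / fact (n + 1 - i)))"
    unfolding sum_distrib_left
  proof (intro sum.cong refl)
    fix i assume "i \<in> {..<n}"
    hence "n + 1 - i = 2 + (n - 1 - i)" by auto
    hence "(of_nat N :: rat) ^ (n + 1 - i) = of_nat N ^ 2 * of_nat N ^ (n - 1 - i)"
      by (simp only: power_add)
    thus "fact n * (fps_nth bernoulli_fps i * (of_nat N ^ (n + 1 - i) / fact (n + 1 - i))) =
      of_nat N ^ 2 * (of_nat (N ^ (n - 1 - i)) * (fact n * fps_nth bernoulli_fps i / fact (n + 1 - i)))"
      by simp
  qed
  finally show ?thesis by simp
qed

text \<open>The weights are integers, so the sum of the exponents needed for the single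
  \<open>a i\<close> serves all of them. They will be powers of \<open>p ^ M\<close>, with
  \<open>M\<close> varying.\<close>

lemma ppow_dvd_sum_clear_denominators:
  assumes p: "prime p"
  shows "\<exists>C. \<forall>w::nat \<Rightarrow> nat. ppow_dvd p 0 (of_nat p ^ C * (\<Sum>i<n. of_nat (w i) * a i))"
proof (induction n)
  case (Suc n)
  then obtain C where C: "\<And>w. ppow_dvd p 0 (of_nat p ^ C * (\<Sum>i<n. of_nat (w i) * a i))" by blast
  obtain D where D: "ppow_dvd p 0 (of_nat p ^ D * a n)"
    using ppow_dvd_clear_denominator[OF p] by blast
  have "ppow_dvd p 0 (of_nat p ^ (C + D) * (\<Sum>i<Suc n. of_nat (w i) * a i))" for w
  proof -
    have "ppow_dvd p 0 (of_int (int p ^ D) * (of_nat p ^ C * (\<Sum>i<n. of_nat (w i) * a i)) +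
        of_int (int p ^ C * int (w n)) * (of_nat p ^ D * a n))"
      by (intro ppow_dvd_add ppow_dvd_int_mult p C D)
    thus ?thesis by (simp add: algebra_simps power_add)
  qed
  thus ?case by blast
qed auto

text \<open>With \<open>C\<close> independent of \<open>M\<close>, this makes \<open>B_n\<close> the
  p-adic limit of the power sums divided by \<open>p ^ M\<close>.\<close>

lemma power_sum_bernoulli_padic:
  assumes p: "prime p"
  shows "\<exists>C. \<forall>M. ppow_dvd p (2 * M)
    (of_nat p ^ C * ((\<Sum>j<p ^ M. of_nat j ^ n) - of_nat p ^ M * bernoulli n))"
proof -
  define R where
    "R N = (\<Sum>i<n. of_nat (N ^ (n - 1 - i)) * (fact n * fps_nth bernoulli_fps i / fact (n + 1 - i)))" for N
  obtain C where "\<forall>w::nat \<Rightarrow> nat. ppow_dvd p 0 (of_nat p ^ C *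
      (\<Sum>i<n. of_nat (w i) * (fact n * fps_nth bernoulli_fps i / fact (n + 1 - i))))"
    using ppow_dvd_sum_clear_denominators[OF p, where n = n and a = "\<lambda>i. fact n * fps_nth bernoulli_fps i / fact (n + 1 - i)"]
    by blast
  hence C: "ppow_dvd p 0 (of_nat p ^ C * R N)" for N
    unfolding R_def by (rule spec)
  have "ppow_dvd p (2 * M) (of_nat p ^ C * ((\<Sum>j<p ^ M. of_nat j ^ n) - of_nat p ^ M * bernoulli n))" for M
  proof -
    have "ppow_dvd p (2 * M + 0) (of_nat p ^ (2 * M) * (of_nat p ^ C * R (p ^ M)))"
      by (subst ppow_dvd_prime_power_mult_iff[OF p]) (rule C)
    moreover have "of_nat p ^ (2 * M) * (of_nat p ^ C * R (p ^ M)) =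
        of_nat p ^ C * ((\<Sum>j<p ^ M. of_nat j ^ n) - of_nat p ^ M * bernoulli n)"
      by (simp add: power_sum_bernoulli R_def power_mult[symmetric] mult_ac)
    ultimately show ?thesis by simp
  qed
  thus ?thesis by blast
qed

section \<open>Voronoi's congruence\<close>

definition unit_residues :: "nat \<Rightarrow> nat \<Rightarrow> nat set" where
  "unit_residues p M = {j. j < p ^ M \<and> coprime j p}"

text \<open>The usual factor \<open>c ^ (n - 1)\<close> is absorbed into the base, so every term is
  a weighted power of the unit \<open>j * c\<close>, to which \<open>unit_power_lift\<close>
  applies.\<close>

definition voronoi_sum :: "nat \<Rightarrow> nat \<Rightarrow> nat \<Rightarrow> nat \<Rightarrow> nat" where
  "voronoi_sum p c M n = (\<Sum>j\<in>unit_residues p M. (j * c div p ^ M) * (j * c) ^ (n - 1))"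

text \<open>Up to sign this is the Riemann zeta value at \<open>1 - n\<close> with the Euler factor
  at \<open>p\<close> removed.\<close>

definition euler_bernoulli :: "nat \<Rightarrow> nat \<Rightarrow> rat" where
  "euler_bernoulli p n = (1 - of_nat p ^ (n - 1)) * (bernoulli n / of_nat n)"

lemma finite_unit_residues [simp]: "finite (unit_residues p M)"
  by (simp add: unit_residues_def)

text \<open>The multiples of \<open>p\<close> below \<open>p ^ Suc M\<close> are \<open>p\<close>
  times the numbers below \<open>p ^ M\<close>. Removing them creates the Euler factor.\<close>

lemma unit_power_sum:
  assumes p: "prime p"
  shows "(\<Sum>j\<in>unit_residues p (Suc M). j ^ n) + p ^ n * (\<Sum>j<p ^ M. j ^ n) = (\<Sum>j<p ^ Suc M. j ^ n)"
proof -
  have p0: "p > 0" using prime_gt_0_nat[OF p] .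
  have "p ^ n * (\<Sum>j<p ^ M. j ^ n) = (\<Sum>j\<in>(*) p ` {..<p ^ M}. j ^ n)"
    using p0 by (subst sum.reindex) (auto simp: inj_on_def power_mult_distrib sum_distrib_left)
  moreover have "{..<p ^ Suc M} = unit_residues p (Suc M) \<union> (*) p ` {..<p ^ M}"
  proof (intro equalityI subsetI)
    fix j assume j: "j \<in> {..<p ^ Suc M}"
    show "j \<in> unit_residues p (Suc M) \<union> (*) p ` {..<p ^ M}"
    proof (cases "p dvd j")
      case True
      then obtain i where "j = p * i" ..
      thus ?thesis using j p0 by auto
    next
      case False
      hence "coprime j p" using p prime_imp_coprime coprime_commute by blast
      thus ?thesis using j by (simp add: unit_residues_def)
    qed
  qed (use p0 in \<open>auto simp: unit_residues_def\<close>)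
  moreover have "unit_residues p (Suc M) \<inter> (*) p ` {..<p ^ M} = {}"
    using p by (auto simp: unit_residues_def)
  ultimately show ?thesis by (simp add: sum.union_disjoint)
qed

lemma bij_betw_unit_residues:
  assumes p: "prime p" and c: "coprime c p"
  shows "bij_betw (\<lambda>j. j * c mod p ^ M) (unit_residues p M) (unit_residues p M)"
proof -
  have p0: "p > 0" using prime_gt_0_nat[OF p] .
  have inj: "inj_on (\<lambda>j. j * c mod p ^ M) (unit_residues p M)"
  proof (rule inj_onI)
    fix i j assume ij: "i \<in> unit_residues p M" "j \<in> unit_residues p M"
      "i * c mod p ^ M = j * c mod p ^ M"
    hence "[i * c = j * c] (mod p ^ M)" by (simp add: cong_def)
    hence "[i = j] (mod p ^ M)" using c by (simp add: cong_mult_rcancel_nat)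
    thus "i = j" using ij cong_less_modulus_unique_nat by (auto simp: unit_residues_def)
  qed
  moreover have "(\<lambda>j. j * c mod p ^ M) ` unit_residues p M \<subseteq> unit_residues p M"
  proof
    fix i assume "i \<in> (\<lambda>j. j * c mod p ^ M) ` unit_residues p M"
    then obtain j where j: "j \<in> unit_residues p M" "i = j * c mod p ^ M" by blast
    show "i \<in> unit_residues p M"
    \<comment> \<open>For \<open>M = 0\<close>, coprimality to \<open>p ^ M\<close> says nothing
      about \<open>p\<close>.\<close>
    proof (cases M)
      case (Suc m)
      have "coprime (j * c) (p ^ M)" using j c by (simp add: unit_residues_def)
      moreover have "p ^ M \<noteq> 0" using p0 by simp
      ultimately have "coprime i (p ^ M)" unfolding j(2) using coprime_mod_left_iff by blast
      thus ?thesis using p0 Suc j(2) by (simp add: unit_residues_def)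
    qed (use j in \<open>auto simp: unit_residues_def\<close>)
  qed
  ultimately show ?thesis
    by (simp add: bij_betw_def endo_inj_surj)
qed

lemma square_dvd_binomial_remainder:
  fixes x d :: "'a :: comm_ring_1"
  shows "d ^ 2 dvd (x + d) ^ n - x ^ n - of_nat n * d * x ^ (n - 1)"
proof (induction n)
  case (Suc n)
  have "(x + d) ^ Suc n - x ^ Suc n - of_nat (Suc n) * d * x ^ n =
      (x + d) * ((x + d) ^ n - x ^ n - of_nat n * d * x ^ (n - 1)) + d ^ 2 * (of_nat n * x ^ (n - 1))"
    by (cases n) (simp_all add: algebra_simps power2_eq_square)
  thus ?case using Suc by simp
qed auto

text \<open>Expand the \<open>n\<close>-th power of the remainder of \<open>j * c\<close> modulo
  \<open>p ^ M\<close> to first order around \<open>j * c\<close>; the error is divisible by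
  \<open>p ^ (2 * M)\<close>. Multiplication by \<open>c\<close> permutes the units, so the
  remainders have the same power sum.\<close>

lemma voronoi_congruence:
  assumes p: "prime p" and c: "coprime c p"
  shows "int p ^ (2 * M) dvd
    (int c ^ n - 1) * int (\<Sum>j\<in>unit_residues p M. j ^ n) - int n * int p ^ M * int (voronoi_sum p c M n)"
proof -
  have "(\<Sum>j\<in>unit_residues p M. int (j * c mod p ^ M) ^ n) = (\<Sum>j\<in>unit_residues p M. int j ^ n)"
    using sum.reindex_bij_betw[OF bij_betw_unit_residues[OF p c], of "\<lambda>j. int j ^ n"] by simp
  hence "(int c ^ n - 1) * int (\<Sum>j\<in>unit_residues p M. j ^ n) =
      (\<Sum>j\<in>unit_residues p M. int (j * c) ^ n - int (j * c mod p ^ M) ^ n)"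
    by (simp add: sum_subtractf sum_distrib_left power_mult_distrib algebra_simps)
  hence "(int c ^ n - 1) * int (\<Sum>j\<in>unit_residues p M. j ^ n) - int n * int p ^ M * int (voronoi_sum p c M n) =
      (\<Sum>j\<in>unit_residues p M. int (j * c) ^ n - int (j * c mod p ^ M) ^ n -
        int n * int p ^ M * (int (j * c div p ^ M) * int (j * c) ^ (n - 1)))"
    by (simp add: sum_subtractf voronoi_sum_def sum_distrib_left)
  also have "int p ^ (2 * M) dvd \<dots>"
  proof (rule dvd_sum)
    fix j
    define x q r where "x = int (j * c)" and "q = int (j * c div p ^ M)" and "r = int (j * c mod p ^ M)"
    define d where "d = - (int p ^ M * q)"
    have "r = x + d"
      using arg_cong[OF mult_div_mod_eq[of "p ^ M" "j * c"], of int]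
      unfolding x_def q_def r_def d_def of_nat_add of_nat_mult[of "p ^ M"] of_nat_power by linarith
    moreover have "int p ^ (2 * M) dvd d ^ 2"
      by (simp add: d_def power_mult_distrib power_mult[symmetric] mult.commute)
    hence "int p ^ (2 * M) dvd (x + d) ^ n - x ^ n - of_nat n * d * x ^ (n - 1)"
      using square_dvd_binomial_remainder dvd_trans by blast
    hence "int p ^ (2 * M) dvd - ((x + d) ^ n - x ^ n - of_nat n * d * x ^ (n - 1))"
      by (simp only: dvd_minus_iff)
    moreover have "- ((x + d) ^ n - x ^ n - of_nat n * d * x ^ (n - 1)) =
        x ^ n - (x + d) ^ n - int n * int p ^ M * (q * x ^ (n - 1))"
      by (simp add: d_def)
    ultimately have "int p ^ (2 * M) dvd x ^ n - r ^ n - int n * int p ^ M * (q * x ^ (n - 1))"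
      by (simp only:)
    thus "int p ^ (2 * M) dvd int (j * c) ^ n - int (j * c mod p ^ M) ^ n -
        int n * int p ^ M * (int (j * c div p ^ M) * int (j * c) ^ (n - 1))"
      by (simp only: x_def q_def r_def)
  qed
  finally show ?thesis .
qed

text \<open>Insert the limit formula for power sums into Voronoi's congruence and cancel
  \<open>n * p ^ M\<close>. Both hold modulo about \<open>p ^ (2 * M)\<close>, so \<open>M\<close>
  digits survive up to a loss independent of \<open>M\<close>.\<close>

lemma voronoi_limit:
  assumes p: "prime p" and c: "coprime c p" and n: "n > 0"
  shows "\<exists>M0. \<forall>M\<ge>M0. ppow_dvd p K
    ((of_nat c ^ n - 1) * euler_bernoulli p n - of_nat (voronoi_sum p c M n))"
proof -
  have p0: "(of_nat p :: rat) \<noteq> 0" using prime_gt_0_nat[OF p] by simp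
  obtain C where C: "\<And>M. ppow_dvd p (2 * M)
      (of_nat p ^ C * ((\<Sum>j<p ^ M. of_nat j ^ n) - of_nat p ^ M * bernoulli n))"
    using power_sum_bernoulli_padic[OF p] by blast
  have ip: "\<not> is_unit p" using p not_prime_unit by auto
  obtain u where u: "n = p ^ multiplicity p n * u" "\<not> p dvd u"
    using multiplicity_decompose'[of n p] n ip by (metis less_irrefl)
  define v where "v = multiplicity p n"
  have "ppow_dvd p K
    ((of_nat c ^ n - 1) * euler_bernoulli p n - of_nat (voronoi_sum p c M n))"
    \<comment> \<open>After multiplication by \<open>p ^ C\<close> the errors are divisible by
      \<open>p ^ (2 * M - 2)\<close>, and \<open>p ^ (C + v + M)\<close> is cancelled at the
      end.\<close>
    if M: "M \<ge> K + 2 + v + C" for M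
  proof -
    obtain m where m: "M = Suc m" using M by (cases M) auto
    define err where "err M = (\<Sum>j<p ^ M. of_nat j ^ n) - of_nat p ^ M * bernoulli n" for M
    define S where "S = (\<Sum>j\<in>unit_residues p M. j ^ n)"
    define y where "y = (of_nat c ^ n - 1) * euler_bernoulli p n - of_nat (voronoi_sum p c M n)"
    have "of_nat S + of_nat p ^ n * (\<Sum>j<p ^ m. of_nat j ^ n) = (\<Sum>j<p ^ M. of_nat j ^ n :: rat)"
      using arg_cong[OF unit_power_sum[OF p, where M = m and n = n], of "of_nat :: nat \<Rightarrow> rat"] m
      by (simp add: S_def)
    \<comment> \<open>This combines the main terms of the two power sums into the Euler
      factor.\<close>
    moreover have "(of_nat p :: rat) ^ n * of_nat p ^ m = of_nat p ^ M * of_nat p ^ (n - 1)"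
      using n by (cases n) (simp_all add: m power_add)
    ultimately have S: "of_nat S = of_nat p ^ M * (of_nat n * euler_bernoulli p n)
        + (err M - of_nat p ^ n * err m)"
      using n unfolding err_def euler_bernoulli_def by (simp add: algebra_simps)
    have err: "ppow_dvd p (2 * m) (of_nat p ^ C * (err M - of_nat p ^ n * err m))"
    proof -
      have "ppow_dvd p (2 * m) (of_nat p ^ C * err M)"
        using ppow_dvd_mono[OF C[of M], of "2 * m"] m by (simp add: err_def)
      moreover have "ppow_dvd p (2 * m) (of_int (int p ^ n) * (of_nat p ^ C * err m))"
        using C[of m] by (intro ppow_dvd_int_mult p) (simp add: err_def)
      ultimately have "ppow_dvd p (2 * m) (of_nat p ^ C * err M - of_int (int p ^ n) * (of_nat p ^ C * err m))"
        by (rule ppow_dvd_diff[OF p])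
      thus ?thesis by (simp add: algebra_simps)
    qed
    have "ppow_dvd p (2 * M) (of_int ((int c ^ n - 1) * int S - int n * int p ^ M * int (voronoi_sum p c M n)))"
      unfolding S_def by (subst ppow_dvd_of_int_iff[OF p]) (rule voronoi_congruence[OF p c])
    hence cong: "ppow_dvd p (2 * m) (of_int ((int c ^ n - 1) * int S - int n * int p ^ M * int (voronoi_sum p c M n)))"
      by (rule ppow_dvd_mono) (simp add: m)
    have "ppow_dvd p (2 * m) (of_int (int p ^ C) *
          of_int ((int c ^ n - 1) * int S - int n * int p ^ M * int (voronoi_sum p c M n))
        - of_int (int c ^ n - 1) * (of_nat p ^ C * (err M - of_nat p ^ n * err m)))"
      by (intro ppow_dvd_diff ppow_dvd_int_mult p err cong)
    also have "of_int (int p ^ C) *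
          of_int ((int c ^ n - 1) * int S - int n * int p ^ M * int (voronoi_sum p c M n))
        - of_int (int c ^ n - 1) * (of_nat p ^ C * (err M - of_nat p ^ n * err m)) =
        of_nat p ^ C * (of_nat n * (of_nat p ^ M * y))"
      by (simp add: S y_def algebra_simps)
    also have "\<dots> = of_nat p ^ (C + v + M) * (of_int (int u) * y)"
      by (subst u(1)) (simp add: v_def power_add)
    finally have "ppow_dvd p (C + v + M + K) (of_nat p ^ (C + v + M) * (of_int (int u) * y))"
      by (rule ppow_dvd_mono) (use M m in simp)
    hence "ppow_dvd p K (of_int (int u) * y)"
      by (simp only: ppow_dvd_prime_power_mult_iff[OF p])
    thus ?thesis
      using u(2) by (subst (asm) ppow_dvd_unit_mult_iff[OF p]) (auto simp: y_def)
  qed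
  thus ?thesis by blast
qed

section \<open>Kummer congruences\<close>

text \<open>The quadratic term is needed for \<open>(1 + p q)^p\<close> modulo \<open>p^3\<close>; doubling avoids the division by 2.\<close>

lemma cube_dvd_binomial_remainder:
  fixes d :: int
  shows "d ^ 3 dvd 2 * ((1 + d) ^ n - 1 - int n * d) - int n * (int n - 1) * d ^ 2"
proof (induction n)
  case (Suc n)
  have "2 * ((1 + d) ^ Suc n - 1 - int (Suc n) * d) - int (Suc n) * (int (Suc n) - 1) * d ^ 2 =
      (1 + d) * (2 * ((1 + d) ^ n - 1 - int n * d) - int n * (int n - 1) * d ^ 2)
      + d ^ 3 * (int n * (int n - 1))"
    by (simp add: algebra_simps power2_eq_square power3_eq_cube)
  thus ?case using Suc by simp
qed auto

text \<open>Raising to the \<open>p\<close>-th power multiplies the linear term by \<open>p\<close>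
  and gains one digit of precision; higher terms vanish at that precision once the factor 2 is
  cancelled, \<open>p\<close> being odd. The same \<open>q\<close> serves all levels
  \<open>k\<close>.\<close>

lemma one_plus_prime_power_lift:
  fixes q :: int
  assumes p: "prime p" "odd p"
  shows "int p ^ (k + 2) dvd (1 + int p * q) ^ (p ^ k * t) - 1 - int p ^ (k + 1) * int t * q"
proof -
  have lift: "int p ^ (k + 2) dvd (1 + int p * q) ^ (p ^ k) - 1 - int p ^ (k + 1) * q" for k
  proof (induction k)
    case (Suc k)
    then obtain w where w: "(1 + int p * q) ^ (p ^ k) - 1 - int p ^ (k + 1) * q = int p ^ (k + 2) * w" ..
    define z where "z = q + int p * w"
    define d where "d = int p ^ (k + 1) * z"
    have y: "(1 + int p * q) ^ (p ^ k) = 1 + d"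
      using w by (simp add: d_def z_def algebra_simps)
    have "int p ^ (k + 3) dvd d ^ 3"
      unfolding d_def power_mult_distrib power_mult[symmetric]
      by (intro dvd_mult2 le_imp_power_dvd) simp
    hence "int p ^ (k + 3) dvd 2 * ((1 + d) ^ p - 1 - int p * d) - int p * (int p - 1) * d ^ 2"
      using cube_dvd_binomial_remainder dvd_trans by blast
    moreover have "int p ^ (k + 3) dvd int p * (int p - 1) * d ^ 2"
    proof -
      have "int p * (int p - 1) * d ^ 2 = int p ^ (k + 3) * (int p ^ k * ((int p - 1) * z ^ 2))"
        by (simp add: d_def power_add power2_eq_square power3_eq_cube)
      thus ?thesis by (simp only: dvd_triv_left)
    qed
    ultimately have "int p ^ (k + 3) dvd 2 * ((1 + d) ^ p - 1 - int p * d)"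
      using dvd_diff_left_iff by blast
    moreover have "coprime (int p ^ (k + 3)) 2" using p by simp
    ultimately have "int p ^ (k + 3) dvd (1 + d) ^ p - 1 - int p * d"
      using coprime_dvd_mult_right_iff by blast
    moreover have "(1 + int p * q) ^ (p ^ Suc k) - 1 - int p ^ (Suc k + 1) * q =
        ((1 + d) ^ p - 1 - int p * d) + int p ^ (k + 3) * w"
      unfolding y[symmetric]
      by (simp add: power_mult[symmetric] d_def z_def algebra_simps power3_eq_cube power_add)
    moreover have "Suc k + 2 = k + 3" by simp
    ultimately show ?case by (simp only: dvd_add dvd_triv_left)
  qed simp
  obtain w where w: "(1 + int p * q) ^ (p ^ k) - 1 - int p ^ (k + 1) * q = int p ^ (k + 2) * w"
    using lift by blast
  define d where "d = int p ^ (k + 1) * (q + int p * w)"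
  have y: "(1 + int p * q) ^ (p ^ k) = 1 + d"
    using w by (simp add: d_def algebra_simps)
  have "int p ^ (k + 2) dvd d ^ 2"
    unfolding d_def power_mult_distrib power_mult[symmetric]
    by (intro dvd_mult2 le_imp_power_dvd) simp
  hence "int p ^ (k + 2) dvd (1 + d) ^ t - 1 ^ t - of_nat t * d * 1 ^ (t - 1)"
    using square_dvd_binomial_remainder dvd_trans by blast
  moreover have "(1 + int p * q) ^ (p ^ k * t) - 1 - int p ^ (k + 1) * int t * q =
      ((1 + d) ^ t - 1 ^ t - of_nat t * d * 1 ^ (t - 1)) + int p ^ (k + 2) * (w * int t)"
    unfolding power_mult y by (simp add: d_def algebra_simps)
  ultimately show ?thesis by (simp only: dvd_add dvd_triv_left)
qed

text \<open>Fermat gives \<open>a ^ (p - 1) = 1 + p * q\<close>, and \<open>D\<close> is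
  \<open>a ^ e * q\<close>. It does not depend on \<open>s\<close>, because
  \<open>(1 + p * q) ^ s\<close> is 1 modulo \<open>p\<close> and multiplies a term already
  divisible by \<open>p ^ (k + 1)\<close>.\<close>

lemma unit_power_lift:
  assumes p: "prime p" "odd p" and a: "coprime a p"
  shows "\<exists>D. \<forall>s k t. int p ^ (k + 2) dvd
    int a ^ (e + (p - 1) * (s + p ^ k * t)) - int a ^ (e + (p - 1) * s) - int p ^ (k + 1) * int t * D"
proof -
  have "\<not> p dvd a" using coprime_absorb_right[of p a] a p not_prime_unit[of p] by blast
  hence "[a ^ (p - 1) = 1] (mod p)" using fermat_theorem p by blast
  hence "[int a ^ (p - 1) = 1] (mod int p)"
    using cong_int_iff[of "a ^ (p - 1)" 1 p] by simp
  then obtain q where "int a ^ (p - 1) - 1 = int p * q"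
    unfolding cong_iff_dvd_diff by blast
  hence q: "int a ^ (p - 1) = 1 + int p * q" by simp
  have "int p ^ (k + 2) dvd int a ^ (e + (p - 1) * (s + p ^ k * t)) - int a ^ (e + (p - 1) * s)
      - int p ^ (k + 1) * int t * (int a ^ e * q)" for s k t
  proof -
    have eq: "int a ^ (e + (p - 1) * m) = int a ^ e * (1 + int p * q) ^ m" for m
      by (simp only: power_add power_mult q)
    have "int p ^ 2 dvd (1 + int p * q) ^ (p ^ 0 * s) - 1 - int p ^ 1 * int s * q"
      using one_plus_prime_power_lift[OF p, of 0 q s] by (simp add: power2_eq_square)
    hence "int p dvd (1 + int p * q) ^ s - 1 - int p * (int s * q)"
      by (auto simp: power2_eq_square mult.assoc dest: dvd_mult_left)
    hence "int p dvd (1 + int p * q) ^ s - 1"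
      by (subst (asm) dvd_diff_left_iff) auto
    hence "int p ^ (k + 1) * int p dvd int p ^ (k + 1) * ((1 + int p * q) ^ s - 1)"
      by (rule mult_dvd_mono[OF dvd_refl])
    hence 1: "int p ^ (k + 2) dvd int p ^ (k + 1) * ((1 + int p * q) ^ s - 1) * (int a ^ e * int t * q)"
      unfolding power_add[of _ k 2] power_add[of _ k 1] power2_eq_square power_one_right
      by - (rule dvd_mult2, simp only: mult.assoc)
    have 2: "int p ^ (k + 2) dvd ((1 + int p * q) ^ (p ^ k * t) - 1 - int p ^ (k + 1) * int t * q)
        * (int a ^ e * (1 + int p * q) ^ s)"
      by (intro dvd_mult2 one_plus_prime_power_lift p)
    have "int a ^ (e + (p - 1) * (s + p ^ k * t)) - int a ^ (e + (p - 1) * s)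
        - int p ^ (k + 1) * int t * (int a ^ e * q) =
        ((1 + int p * q) ^ (p ^ k * t) - 1 - int p ^ (k + 1) * int t * q) * (int a ^ e * (1 + int p * q) ^ s)
        + int p ^ (k + 1) * ((1 + int p * q) ^ s - 1) * (int a ^ e * int t * q)"
      unfolding eq by (simp add: power_add algebra_simps)
    thus ?thesis using 1 2 by (simp only: dvd_add)
  qed
  thus ?thesis by blast
qed

text \<open>The weights \<open>j * c div p ^ M\<close> do not involve the exponent, so the constants
  for the single units add up, with these weights, to one \<open>D\<close>.\<close>

lemma voronoi_sum_lift:
  assumes p: "prime p" "odd p" and c: "coprime c p" and l: "l > 0"
  shows "\<exists>D. \<forall>s k t. int p ^ (k + 2) dvd
    int (voronoi_sum p c M (l + (p - 1) * (s + p ^ k * t))) - int (voronoi_sum p c M (l + (p - 1) * s))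
      - int p ^ (k + 1) * int t * D"
proof -
  have "\<forall>j\<in>unit_residues p M. \<exists>D. \<forall>s k t. int p ^ (k + 2) dvd
      int (j * c) ^ (l - 1 + (p - 1) * (s + p ^ k * t)) - int (j * c) ^ (l - 1 + (p - 1) * s)
      - int p ^ (k + 1) * int t * D"
    using c by (intro ballI unit_power_lift p) (simp add: unit_residues_def)
  then obtain D where D: "\<And>j s k t. j \<in> unit_residues p M \<Longrightarrow> int p ^ (k + 2) dvd
      int (j * c) ^ (l - 1 + (p - 1) * (s + p ^ k * t)) - int (j * c) ^ (l - 1 + (p - 1) * s)
      - int p ^ (k + 1) * int t * D j"
    by metis
  have e: "l + m - 1 = l - 1 + m" for m using l by simp
  have "int p ^ (k + 2) dvd
    int (voronoi_sum p c M (l + (p - 1) * (s + p ^ k * t))) - int (voronoi_sum p c M (l + (p - 1) * s))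
      - int p ^ (k + 1) * int t * (\<Sum>j\<in>unit_residues p M. int (j * c div p ^ M) * D j)" for s k t
  proof -
    have "int (voronoi_sum p c M (l + (p - 1) * (s + p ^ k * t))) - int (voronoi_sum p c M (l + (p - 1) * s))
      - int p ^ (k + 1) * int t * (\<Sum>j\<in>unit_residues p M. int (j * c div p ^ M) * D j) =
      (\<Sum>j\<in>unit_residues p M. int (j * c div p ^ M) *
        (int (j * c) ^ (l - 1 + (p - 1) * (s + p ^ k * t)) - int (j * c) ^ (l - 1 + (p - 1) * s)
          - int p ^ (k + 1) * int t * D j))"
      unfolding voronoi_sum_def e of_nat_sum of_nat_mult[of "_ div _"] of_nat_power
      by (simp only: right_diff_distrib sum_subtractf sum_distrib_left mult_ac)
    also have "int p ^ (k + 2) dvd \<dots>"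
      using D by (intro dvd_sum dvd_mult) blast
    finally show ?thesis .
  qed
  thus ?thesis by blast
qed

text \<open>A primitive root has order \<open>p - 1\<close>. Such a \<open>c\<close> makes the
  factor \<open>c ^ n - 1\<close> in Voronoi's congruence a unit at \<open>p\<close> for all
  \<open>n\<close> congruent to \<open>l\<close> modulo \<open>p - 1\<close>.\<close>

lemma exists_unit_power_ne_one:
  assumes p: "prime p" and l: "\<not> (p - 1) dvd l"
  shows "\<exists>c. coprime c p \<and> \<not> [c ^ l = 1] (mod p)"
proof -
  obtain g where g: "residue_primroot p g"
    using prime_primitive_root_exists[OF prime_gt_1_nat[OF p] p] by blast
  hence "coprime g p" "ord p g = p - 1"
    using p by (auto simp: residue_primroot_def totient_prime coprime_commute)
  thus ?thesis using l ord_divides[of g l p] by auto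
qed

section \<open>Interpolation along a residue class modulo p - 1\<close>

locale kummer =
  fixes p l :: nat
  assumes prime_p: "prime p" and odd_p: "odd p" and l_pos: "l > 0" and l_ndvd: "\<not> (p - 1) dvd l"
begin

text \<open>Up to sign, these are values of one branch of the p-adic zeta function, with
  \<open>s\<close> as the p-adic variable.\<close>

definition interp :: "nat \<Rightarrow> rat" where
  "interp s = euler_bernoulli p (l + (p - 1) * s)"

text \<open>The threshold for \<open>M\<close> in \<open>voronoi_limit\<close> varies with
  \<open>s\<close>, so a single \<open>M\<close> is taken beyond the thresholds of four points only:
  two to be compared, and 0 and 1 for the slope. \<open>C\<close> comes from
  \<open>c ^ n - 1\<close> and \<open>F\<close> from the Voronoi sum.\<close>

lemma voronoi_approximation:
  obtains C F D E where
    "\<And>s. \<not> int p dvd C s" "\<And>s. int p dvd C s - C 0"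
    "\<And>s k t. int p ^ (k + 2) dvd C (s + p ^ k * t) - C s - int p ^ (k + 1) * int t * E"
    "\<And>s k t. int p ^ (k + 2) dvd F (s + p ^ k * t) - F s - int p ^ (k + 1) * int t * D"
    "\<And>s. s \<in> {s1, s2, 0, 1} \<Longrightarrow> ppow_dvd p K (of_int (C s) * interp s - of_int (F s))"
proof -
  obtain c where c: "coprime c p" "\<not> [c ^ l = 1] (mod p)"
    using exists_unit_power_ne_one[OF prime_p l_ndvd] by blast
  define C where "C s = int c ^ (l + (p - 1) * s) - 1" for s
  have "\<exists>M0. \<forall>s. \<forall>M\<ge>M0 s. ppow_dvd p K
      (of_int (C s) * interp s - of_nat (voronoi_sum p c M (l + (p - 1) * s)))"
    using voronoi_limit[OF prime_p c(1), of "l + (p - 1) * _" K] l_pos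
    by (intro choice allI) (simp add: C_def interp_def)
  then obtain M0 where M0: "\<And>s M. M \<ge> M0 s \<Longrightarrow> ppow_dvd p K
      (of_int (C s) * interp s - of_nat (voronoi_sum p c M (l + (p - 1) * s)))"
    by blast
  define M where "M = M0 s1 + M0 s2 + M0 0 + M0 1"
  define F where "F s = int (voronoi_sum p c M (l + (p - 1) * s))" for s
  obtain D where D: "\<And>s k t. int p ^ (k + 2) dvd F (s + p ^ k * t) - F s - int p ^ (k + 1) * int t * D"
    using voronoi_sum_lift[OF prime_p odd_p c(1) l_pos, of M] unfolding F_def by blast
  obtain E where E: "\<And>s k t. int p ^ (k + 2) dvd C (s + p ^ k * t) - C s - int p ^ (k + 1) * int t * E"
    using unit_power_lift[OF prime_p odd_p c(1), of l] unfolding C_def by force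
  have "int p ^ 2 dvd C s - C 0 - int p * (int s * E)" for s
    using E[of 0 0 s] by (simp add: mult.assoc power2_eq_square)
  hence "int p dvd C s - C 0 - int p * (int s * E)" for s
    using dvd_mult_left[of "int p" "int p"] unfolding power2_eq_square by blast
  hence C: "int p dvd C s - C 0" for s
    by (subst (asm) dvd_diff_left_iff) auto
  have "\<not> [int (c ^ l) = int 1] (mod int p)"
    using c(2) cong_int_iff by blast
  hence "\<not> int p dvd C 0" by (simp add: C_def cong_iff_dvd_diff)
  hence nd: "\<not> int p dvd C s" for s using C[of s] dvd_diff[of "int p" "C s" "C s - C 0"] by auto
  have "ppow_dvd p K (of_int (C s) * interp s - of_int (F s))" if "s \<in> {s1, s2, 0, 1}" for s
    using that M0[of s M] by (auto simp: M_def F_def)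
  thus ?thesis by (rule that[OF nd C E D])
qed

text \<open>Adams' integrality theorem, with the Euler factor attached: \<open>C s\<close> is a unit
  and \<open>F s\<close> an integer.\<close>

lemma interp_integral: "ppow_dvd p 0 (interp s)"
proof -
  obtain C F D E where C: "\<And>s. \<not> int p dvd C s"
    and F: "\<And>s'. s' \<in> {s, s, 0, 1} \<Longrightarrow> ppow_dvd p 0 (of_int (C s') * interp s' - of_int (F s'))"
    by (rule voronoi_approximation[of s s 0]) (rule that, assumption+)
  have "ppow_dvd p 0 ((of_int (C s) * interp s - of_int (F s)) + of_int (F s))"
    by (intro ppow_dvd_add prime_p F) (auto simp: ppow_dvd_of_int_iff prime_p)
  thus ?thesis using ppow_dvd_unit_mult_iff[OF prime_p C[of s]] by simp
qed

text \<open>\<open>C\<close> and \<open>F\<close> both change by multiples of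
  \<open>p ^ (k + 1)\<close>, and the change of \<open>C\<close> multiplies an integral
  value.\<close>

theorem kummer_congruence: "ppow_dvd p (k + 1) (interp (s + p ^ k * t) - interp s)"
proof -
  define s' where "s' = s + p ^ k * t"
  obtain C F D E where C: "\<And>s. \<not> int p dvd C s"
    and CE: "\<And>s k t. int p ^ (k + 2) dvd C (s + p ^ k * t) - C s - int p ^ (k + 1) * int t * E"
    and FD: "\<And>s k t. int p ^ (k + 2) dvd F (s + p ^ k * t) - F s - int p ^ (k + 1) * int t * D"
    and F: "\<And>u. u \<in> {s, s', 0, 1} \<Longrightarrow> ppow_dvd p (k + 1) (of_int (C u) * interp u - of_int (F u))"
    by (rule voronoi_approximation[of s s' "k + 1"]) (rule that, assumption+)
  have dvd: "int p ^ (k + 1) dvd x" if "int p ^ (k + 2) dvd x - int p ^ (k + 1) * int t * y" for x y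
  proof -
    have "int p ^ (k + 1) dvd x - int p ^ (k + 1) * int t * y"
      using that by (rule power_le_dvd) simp
    moreover have "int p ^ (k + 1) dvd int p ^ (k + 1) * int t * y"
      by (simp only: mult.assoc dvd_triv_left)
    ultimately show ?thesis using dvd_diff_left_iff by blast
  qed
  have FF: "ppow_dvd p (k + 1) (of_int (F s' - F s))"
    using dvd[OF FD] by (simp only: ppow_dvd_of_int_iff prime_p s'_def)
  have "ppow_dvd p (k + 1 + 0) (of_int (C s' - C s) * interp s')"
    using dvd[OF CE] by (intro ppow_dvd_mult interp_integral prime_p)
      (simp only: ppow_dvd_of_int_iff prime_p s'_def)
  hence CC: "ppow_dvd p (k + 1) (of_int (C s' - C s) * interp s')" by simp
  have "ppow_dvd p (k + 1)
      ((of_int (C s') * interp s' - of_int (F s')) - (of_int (C s) * interp s - of_int (F s))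
      + of_int (F s' - F s) - of_int (C s' - C s) * interp s')"
    by (rule ppow_dvd_diff[OF prime_p ppow_dvd_add[OF prime_p
          ppow_dvd_diff[OF prime_p F F] FF] CC]) simp_all
  also have "\<dots> = of_int (C s) * (interp s' - interp s)"
    by (simp add: algebra_simps)
  finally show ?thesis
    using ppow_dvd_unit_mult_iff[OF prime_p C[of s]] by (simp add: s'_def)
qed

text \<open>Since \<open>p\<close> divides all values of \<open>interp\<close>, the change of
  \<open>C\<close> only contributes multiples of \<open>p ^ (k + 2)\<close>. So
  \<open>interp\<close> inherits the linear term of \<open>F\<close>, and its unknown coefficient
  \<open>D\<close> is eliminated through the step from 0 to 1.\<close>

theorem kummer_congruence_refined:
  assumes "ppow_dvd p 1 (interp 0)"
  shows "ppow_dvd p (k + 2) (interp (s + p ^ k * t) - interp s - of_nat (p ^ k * t) * (interp 1 - interp 0))"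
proof -
  define s' where "s' = s + p ^ k * t"
  obtain C F D E where C: "\<And>s. \<not> int p dvd C s" and C0: "\<And>s. int p dvd C s - C 0"
    and CE: "\<And>s k t. int p ^ (k + 2) dvd C (s + p ^ k * t) - C s - int p ^ (k + 1) * int t * E"
    and FD: "\<And>s k t. int p ^ (k + 2) dvd F (s + p ^ k * t) - F s - int p ^ (k + 1) * int t * D"
    and F: "\<And>u. u \<in> {s, s', 0, 1} \<Longrightarrow> ppow_dvd p (k + 2) (of_int (C u) * interp u - of_int (F u))"
    by (rule voronoi_approximation[of s s' "k + 2"]) (rule that, assumption+)
  have interp: "ppow_dvd p 1 (interp u)" for u
    using ppow_dvd_add[OF prime_p kummer_congruence[of 0 0 u, simplified] assms[simplified]] by simp
  have step: "ppow_dvd p (j + 2)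
      (of_int (C u) * (interp (u + p ^ j * v) - interp u) - of_int (int p ^ (j + 1) * int v * D))"
    if "u \<in> {s, s', 0, 1}" "u + p ^ j * v \<in> {s, s', 0, 1}" "j \<le> k" for u v j
  proof -
    define u' where "u' = u + p ^ j * v"
    have CC: "int p ^ (j + 1) dvd C u' - C u"
    proof -
      have "int p ^ (j + 1) dvd C u' - C u - int p ^ (j + 1) * int v * E"
        using CE[of j u v] unfolding u'_def by (rule power_le_dvd) simp
      moreover have "int p ^ (j + 1) dvd int p ^ (j + 1) * int v * E"
        by (simp only: mult.assoc dvd_triv_left)
      ultimately show ?thesis using dvd_diff_left_iff by blast
    qed
    have "ppow_dvd p (j + 1 + 1) (of_int (C u' - C u) * interp u')"
      using CC by (intro ppow_dvd_mult interp prime_p) (simp only: ppow_dvd_of_int_iff prime_p)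
    hence CC': "ppow_dvd p (j + 2) (of_int (C u' - C u) * interp u')" by simp
    have FF: "ppow_dvd p (j + 2) (of_int (F u' - F u - int p ^ (j + 1) * int v * D))"
      using FD[of j u v] by (simp only: ppow_dvd_of_int_iff prime_p u'_def)
    have Fw: "ppow_dvd p (j + 2) (of_int (C w) * interp w - of_int (F w))" if "w \<in> {u, u'}" for w
    proof -
      have "w \<in> {s, s', 0, 1}" using that \<open>u \<in> _\<close> \<open>u + p ^ j * v \<in> _\<close> unfolding u'_def by auto
      thus ?thesis using ppow_dvd_mono[OF F] \<open>j \<le> k\<close> by simp
    qed
    have "ppow_dvd p (j + 2)
        ((of_int (C u') * interp u' - of_int (F u')) - (of_int (C u) * interp u - of_int (F u))
        + of_int (F u' - F u - int p ^ (j + 1) * int v * D) - of_int (C u' - C u) * interp u')"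
      by (rule ppow_dvd_diff[OF prime_p ppow_dvd_add[OF prime_p
            ppow_dvd_diff[OF prime_p Fw Fw] FF] CC']) simp_all
    thus ?thesis by (simp add: u'_def algebra_simps)
  qed
  have 1: "ppow_dvd p (k + 2) (of_int (C s) * (interp s' - interp s) - of_int (int p ^ (k + 1) * int t * D))"
    using step[of s k t] by (simp add: s'_def)
  \<comment> \<open>The unit \<open>C s\<close> is replaced by \<open>C 0\<close>, which does not
    depend on \<open>s\<close>: the two agree modulo \<open>p\<close>, and the difference of values
    already has \<open>p ^ (k + 1)\<close>.\<close>
  have "ppow_dvd p 1 (of_int (C s - C 0))"
    using C0[of s] by (simp only: ppow_dvd_of_int_iff prime_p power_one_right)
  hence "ppow_dvd p (1 + (k + 1)) (of_int (C s - C 0) * (interp s' - interp s))"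
    unfolding s'_def by (intro ppow_dvd_mult prime_p kummer_congruence)
  hence 2: "ppow_dvd p (k + 2) (of_int (C s - C 0) * (interp s' - interp s))" by simp
  \<comment> \<open>The step from 0 to 1 at level 0 identifies \<open>p * D\<close> with
    \<open>C 0\<close> times the slope modulo \<open>p ^ 2\<close>.\<close>
  have 3: "ppow_dvd p (k + 2) (of_nat p ^ k * (of_int (int t) *
      (of_int (C 0) * (interp 1 - interp 0) - of_int (int p * D))))"
    unfolding ppow_dvd_prime_power_mult_iff[OF prime_p]
    using step[of 0 0 1] by (intro ppow_dvd_int_mult prime_p) (simp add: numeral_2_eq_2)
  have "ppow_dvd p (k + 2) ((of_int (C s) * (interp s' - interp s) - of_int (int p ^ (k + 1) * int t * D))
     - of_int (C s - C 0) * (interp s' - interp s) - (of_nat p ^ k * (of_int (int t) *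
      (of_int (C 0) * (interp 1 - interp 0) - of_int (int p * D)))))"
    by (rule ppow_dvd_diff[OF prime_p ppow_dvd_diff[OF prime_p 1 2] 3])
  also have "\<dots> = of_int (C 0) * (interp s' - interp s - of_nat (p ^ k * t) * (interp 1 - interp 0))"
    by (simp add: algebra_simps)
  finally show ?thesis
    using ppow_dvd_unit_mult_iff[OF prime_p C[of 0]] by (simp add: s'_def)
qed

end

section \<open>Irregular pairs\<close>

text \<open>Common end of the computations of \<open>padic_ord\<close> and \<open>h0\<close>: in
  both, level \<open>k\<close> is reached iff \<open>p ^ Suc k\<close> divides the value of order
  \<delta>.\<close>

lemma one_plus_Sup_enat:
  assumes "\<delta> \<ge> 1"
  shows "1 + Sup {enat k |k. Suc k \<le> \<delta>} = enat \<delta>"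
proof -
  have "Sup {enat k |k. Suc k \<le> \<delta>} = enat (\<delta> - 1)"
    using assms by (intro cSup_eq_maximum) auto
  thus ?thesis using assms by (simp add: one_enat_def)
qed

lemma digit_sum_less:
  fixes d :: "nat \<Rightarrow> nat"
  assumes "\<And>i. i < k \<Longrightarrow> d i < p"
  shows "(\<Sum>i<k. d i * p ^ i) < p ^ k"
  using assms
proof (induction k)
  case (Suc k)
  have "(\<Sum>i<Suc k. d i * p ^ i) < (d k + 1) * p ^ k" using Suc by simp
  also have "\<dots> \<le> p * p ^ k" using Suc.prems[of k] by (intro mult_right_mono) auto
  finally show ?case by simp
qed simp

locale kummer_pair =
  fixes p l :: nat
  assumes prime_p: "prime p" and l_pos: "l > 0" and l_even: "even l" and l_less: "l < p - 1"

sublocale kummer_pair \<subseteq> kummer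
proof
  show "odd p"
    using prime_p l_pos l_less prime_odd_nat[OF prime_p] by force
  show "\<not> (p - 1) dvd l" using l_pos l_less by (simp add: nat_dvd_not_less)
qed (use prime_p l_pos in auto)

context kummer_pair
begin

abbreviation index :: "nat \<Rightarrow> nat" where "index s \<equiv> l + (p - 1) * s"

abbreviation bernoulli_quot :: "nat \<Rightarrow> rat" where "bernoulli_quot s \<equiv> bernoulli (index s) / of_nat (index s)"

lemma p_gt_1: "p > 1"
  using prime_gt_1_nat[OF prime_p] .

lemma totient_eq: "totient (p ^ Suc k) = (p - 1) * p ^ k"
  by (simp only: totient_prime_power_Suc[OF prime_p] mult.commute)

lemma l_ge_2: "l \<ge> 2"
  using l_even l_pos by presburger

lemma even_index: "even (index s)"
  using l_even odd_p by simp

text \<open>The Euler factor is a unit at \<open>p\<close>, as \<open>index s\<close> is at least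
  2.\<close>

lemma ppow_dvd_quot_iff: "ppow_dvd p k (bernoulli_quot s) \<longleftrightarrow> ppow_dvd p k (interp s)"
proof -
  have "int p dvd int p ^ (index s - 1)" using l_ge_2 by (intro dvd_power) auto
  moreover have "\<not> int p dvd 1" using p_gt_1 by simp
  ultimately have u: "\<not> int p dvd 1 - int p ^ (index s - 1)" by (simp add: dvd_diff_left_iff)
  have "interp s = of_int (1 - int p ^ (index s - 1)) * bernoulli_quot s"
    by (simp add: interp_def euler_bernoulli_def)
  thus ?thesis by (simp only: ppow_dvd_unit_mult_iff[OF prime_p u])
qed

text \<open>\<open>Delta\<close> is built without Euler factors. Dropping one costs a power of
  \<open>p\<close> with positive exponent times a value divisible by \<open>p\<close>.\<close>

lemma ppow_dvd_quot_minus_interp: "ppow_dvd p 1 (bernoulli_quot s) \<Longrightarrow> ppow_dvd p 2 (bernoulli_quot s - interp s)"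
proof -
  assume "ppow_dvd p 1 (bernoulli_quot s)"
  hence "ppow_dvd p ((index s - 1) + 1) (of_nat p ^ (index s - 1) * bernoulli_quot s)"
    unfolding ppow_dvd_prime_power_mult_iff[OF prime_p] .
  hence "ppow_dvd p 2 (of_nat p ^ (index s - 1) * bernoulli_quot s)"
    by (rule ppow_dvd_mono) (use l_ge_2 in simp)
  moreover have "bernoulli_quot s - interp s = of_nat p ^ (index s - 1) * bernoulli_quot s"
    by (simp only: interp_def euler_bernoulli_def left_diff_distrib mult_1_left diff_diff_eq2 add_diff_cancel_left')
  ultimately show ?thesis by (simp only:)
qed

text \<open>With \<open>l < p - 1\<close>, the bound on \<open>s\<close> puts \<open>index s\<close>
  below \<open>totient (p ^ Suc k) = (p - 1) * p ^ k\<close>; this causes the shift between the two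
  exponents.\<close>

lemma Psi_irr_iff:
  assumes "s < p ^ k"
  shows "(p, index s) \<in> Psi_irr (Suc k) \<longleftrightarrow> ppow_dvd p (Suc k) (interp s)"
proof -
  have "index s < (p - 1) + (p - 1) * s" using l_less by simp
  also have "\<dots> = (p - 1) * Suc s" by simp
  also have "\<dots> \<le> (p - 1) * p ^ k" using assms by (intro mult_left_mono) auto
  also have "\<dots> = totient (p ^ Suc k)"
    by (simp only: totient_eq)
  finally have "index s < totient (p ^ Suc k)" .
  thus ?thesis
    using prime_p odd_p l_ge_2 even_index[of s] ppow_dvd_quot_iff[of "Suc k" s]
    by (simp add: Psi_irr_def)
qed

lemma kummer_cong:
  assumes "[s = s'] (mod p ^ k)"
  shows "ppow_dvd p (Suc k) (interp s' - interp s)"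
proof -
  have *: "ppow_dvd p (Suc k) (interp b - interp a)" if "a \<le> b" "[b = a] (mod p ^ k)" for a b
    using that kummer_congruence[of k a] by (auto simp: cong_le_nat add.commute mult.commute)
  show ?thesis
  proof (cases "s \<le> s'")
    case False
    hence "ppow_dvd p (Suc k) (- (interp s - interp s'))"
      using assms by (intro ppow_dvd_minus prime_p *) auto
    thus ?thesis by simp
  qed (use * assms cong_sym in blast)
qed

lemma ppow_dvd_interp_cong:
  assumes "[s = s'] (mod p ^ k)" "j \<le> Suc k"
  shows "ppow_dvd p j (interp s) \<longleftrightarrow> ppow_dvd p j (interp s')"
proof -
  have "ppow_dvd p j (interp s)" if "[s = s'] (mod p ^ k)" "ppow_dvd p j (interp s')" for s s'
    using ppow_dvd_diff[OF prime_p that(2) ppow_dvd_mono[OF kummer_cong[OF that(1)] assms(2)]] by simp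
  thus ?thesis using assms(1) cong_sym by blast
qed

lemma kummer_cong_refined:
  assumes "ppow_dvd p 1 (interp 0)" "[s = s'] (mod p ^ k)"
  shows "ppow_dvd p (k + 2) (interp s' - interp s - of_int (int s' - int s) * (interp 1 - interp 0))"
proof -
  have *: "ppow_dvd p (k + 2) (interp b - interp a - of_int (int b - int a) * (interp 1 - interp 0))"
    if "a \<le> b" "[b = a] (mod p ^ k)" for a b
    using that kummer_congruence_refined[OF assms(1), of k a]
    by (auto simp: cong_le_nat add.commute mult.commute)
  show ?thesis
  proof (cases "s \<le> s'")
    case False
    hence "ppow_dvd p (k + 2) (- (interp s - interp s' - of_int (int s - int s') * (interp 1 - interp 0)))"
      using assms by (intro ppow_dvd_minus prime_p *) auto
    thus ?thesis by (simp add: algebra_simps)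
  qed (use * assms cong_sym in blast)
qed

text \<open>Both Bernoulli quotients are divisible by \<open>p\<close>, so their difference over
  \<open>p\<close> is integral and has a unique residue. That residue is 0 iff the difference is
  divisible by \<open>p ^ 2\<close>, and Euler factors do not matter to that precision.\<close>

lemma Delta_eq_0_iff:
  assumes "ppow_dvd p 1 (interp 0)"
  shows "Delta 1 p l = 0 \<longleftrightarrow> ppow_dvd p 2 (interp 1 - interp 0)"
proof -
  define x where "x = (bernoulli_quot 1 - bernoulli_quot 0) / of_nat p"
  have px: "of_nat p ^ 1 * x = bernoulli_quot 1 - bernoulli_quot 0" using p_gt_1 by (simp add: x_def)
  have interp: "ppow_dvd p 1 (interp 1)" using ppow_dvd_interp_cong[of 1 0 0 1] assms by simp
  have "ppow_dvd p 2 ((bernoulli_quot 1 - interp 1) - (bernoulli_quot 0 - interp 0))"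
    using assms interp by (intro ppow_dvd_diff prime_p ppow_dvd_quot_minus_interp) (simp_all only: ppow_dvd_quot_iff)
  hence d: "ppow_dvd p 2 ((bernoulli_quot 1 - bernoulli_quot 0) - (interp 1 - interp 0))" by (simp add: algebra_simps)
  have "ppow_dvd p 2 (bernoulli_quot 1 - bernoulli_quot 0) \<longleftrightarrow> ppow_dvd p 2 (interp 1 - interp 0)"
    using ppow_dvd_add[OF prime_p d, of "interp 1 - interp 0"] ppow_dvd_diff[OF prime_p _ d, of "bernoulli_quot 1 - bernoulli_quot 0"]
    by auto
  moreover have "ppow_dvd p 2 (bernoulli_quot 1 - bernoulli_quot 0) \<longleftrightarrow> ppow_dvd p 1 x"
    using ppow_dvd_prime_power_mult_iff[OF prime_p, of 1 1 x] unfolding px by (simp add: numeral_2_eq_2)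
  moreover have "ppow_dvd p 1 (bernoulli_quot 1 - bernoulli_quot 0)"
    using assms interp by (intro ppow_dvd_diff prime_p) (simp_all only: ppow_dvd_quot_iff)
  hence "ppow_dvd p 0 x"
    using ppow_dvd_prime_power_mult_iff[OF prime_p, of 1 0 x] unfolding px by simp
  hence ex1: "\<exists>!d. d < p \<and> ppow_dvd p 1 (of_nat d - x)"
    by (rule ppow_dvd_residue_unique[OF prime_p])
  \<comment> \<open>As \<open>totient p = p - 1\<close>, the shift of \<open>l\<close> is the step
    from \<open>s = 0\<close> to \<open>s = 1\<close>.\<close>
  have D: "Delta 1 p l = (THE d. d < p \<and> ppow_dvd p 1 (of_nat d - x))"
    unfolding Delta_def x_def using prime_p by (simp add: totient_prime)
  have "Delta 1 p l = 0 \<longleftrightarrow> ppow_dvd p 1 x"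
  proof
    assume "Delta 1 p l = 0"
    hence "ppow_dvd p 1 (of_nat 0 - x)" using theI'[OF ex1] unfolding D by simp
    thus "ppow_dvd p 1 x" using ppow_dvd_minus[OF prime_p, of 1 "- x"] by simp
  next
    assume "ppow_dvd p 1 x"
    thus "Delta 1 p l = 0"
      unfolding D using p_gt_1 ppow_dvd_minus[OF prime_p] by (intro the1_equality ex1) simp
  qed
  ultimately show ?thesis by simp
qed

text \<open>The weights are 1 and then \<open>(p - 1) * p ^ i\<close>, so the entries after
  \<open>l\<close> are the base \<open>p\<close> digits of the argument of
  \<open>interp\<close>.\<close>

lemma Psi_irr_hat_iff:
  assumes "s 0 = l"
  shows "(p, map s [0..<Suc k]) \<in> Psi_irr_hat (Suc k) \<longleftrightarrow>
    (\<forall>i<k. s (Suc i) < p) \<and> ppow_dvd p (Suc k) (interp (\<Sum>i<k. s (Suc i) * p ^ i))"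
proof -
  have nth: "map s [0..<Suc k] ! i = s i" if "i < Suc k" for i
    using that by (simp del: upt_Suc)
  have "l \<le> p - 3" "l < p" using l_less l_even odd_p by presburger+
  moreover have "(\<forall>i<Suc k. s i < p) \<longleftrightarrow> s 0 < p \<and> (\<forall>i<k. s (Suc i) < p)"
    by (auto simp: less_Suc_eq_0_disj)
  moreover have "(\<Sum>i<Suc k. map s [0..<Suc k] ! i * totient (p ^ i)) = index (\<Sum>i<k. s (Suc i) * p ^ i)"
  proof -
    have "(\<Sum>i<Suc k. map s [0..<Suc k] ! i * totient (p ^ i)) = (\<Sum>i<Suc k. s i * totient (p ^ i))"
      by (intro sum.cong refl) (simp add: nth del: upt_Suc)
    also have "\<dots> = index (\<Sum>i<k. s (Suc i) * p ^ i)"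
      unfolding sum.lessThan_Suc_shift using assms prime_p
      by (simp add: totient_eq sum_distrib_left mult_ac del: power_Suc)
    finally show ?thesis .
  qed
  ultimately have "(p, map s [0..<Suc k]) \<in> Psi_irr_hat (Suc k) \<longleftrightarrow>
      (\<forall>i<k. s (Suc i) < p) \<and> (p, index (\<Sum>i<k. s (Suc i) * p ^ i)) \<in> Psi_irr (Suc k)"
    using assms l_even l_ge_2 unfolding Psi_irr_hat_def
    by (simp add: nth del: upt_Suc sum.lessThan_Suc)
  thus ?thesis
    using Psi_irr_iff[OF digit_sum_less[of k "\<lambda>i. s (Suc i)" p]] by blast
qed

text \<open>The tuple stands for \<open>index l\<close>, which is \<open>l * p\<close>.\<close>

lemma Psi_irr_hat_double_iff: "(p, [l, l]) \<in> Psi_irr_hat 2 \<longleftrightarrow> ppow_dvd p 2 (interp l)"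
proof -
  have "(p, map (\<lambda>_. l) [0..<Suc 1]) \<in> Psi_irr_hat (Suc 1) \<longleftrightarrow> ppow_dvd p (Suc 1) (interp l)"
    using l_less by (subst Psi_irr_hat_iff) auto
  thus ?thesis by (simp add: numeral_2_eq_2)
qed

section \<open>The tree for vanishing slope\<close>

text \<open>With slope divisible by \<open>p ^ 2\<close>, the affine term vanishes modulo
  \<open>p ^ (r + 2)\<close> on classes modulo \<open>p ^ r\<close>. Hence a zero modulo
  \<open>p ^ (r + 1)\<close> has either all \<open>p\<close> lifts or none, exactly as a node has
  \<open>p\<close> children or none.\<close>

lemma T0_nodes_iff:
  assumes f0: "ppow_dvd p 1 (interp 0)" and e: "ppow_dvd p 2 (interp 1 - interp 0)"
  shows "(r, l') \<in> T0_nodes p l \<longleftrightarrow> (\<exists>s<p ^ r. l' = index s \<and> ppow_dvd p (Suc r) (interp s))"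
proof -
  have lift: "ppow_dvd p (r + 2) (interp s) \<longleftrightarrow> ppow_dvd p (r + 2) (interp s')" if c: "[s = s'] (mod p ^ r)" for s s' r
  proof -
    have *: "ppow_dvd p (r + 2) (interp b - interp a)" if "[a = b] (mod p ^ r)" for a b
    proof -
      have "int p ^ r dvd int b - int a"
        using that by (metis cong_iff_dvd_diff cong_int_iff cong_sym of_nat_power)
      hence "ppow_dvd p (r + 2) (of_int (int b - int a) * (interp 1 - interp 0))"
        by (intro ppow_dvd_mult e prime_p) (simp only: ppow_dvd_of_int_iff prime_p)
      hence "ppow_dvd p (r + 2) ((interp b - interp a - of_int (int b - int a) * (interp 1 - interp 0)) + of_int (int b - int a) * (interp 1 - interp 0))"
        using kummer_cong_refined[OF f0 that] by (intro ppow_dvd_add prime_p)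
      thus ?thesis by simp
    qed
    show ?thesis
      using ppow_dvd_add[OF prime_p *[OF c], of "interp s"] ppow_dvd_add[OF prime_p *[OF cong_sym[OF c]], of "interp s'"]
      by auto
  qed
  have tot: "totient (p ^ (r + 1)) = (p - 1) * p ^ r" for r
    using totient_eq by simp
  have pr: "p ^ r \<le> p ^ Suc r" for r using p_gt_1 by simp
  show ?thesis
  proof
    assume "(r, l') \<in> T0_nodes p l"
    thus "\<exists>s<p ^ r. l' = index s \<and> ppow_dvd p (Suc r) (interp s)"
    proof (induction rule: T0_nodes.induct)
      case root
      show ?case using f0 by (intro exI[of _ 0]) simp
    next
      case (child r l' j)
      then obtain s where s: "s < p ^ r" "l' = index s" by blast
      have "ppow_dvd p (r + 2) (interp s)"
        using Psi_irr_iff[OF less_le_trans[OF s(1) pr]] s(2) child.hyps(2) by simp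
      hence "ppow_dvd p (r + 2) (interp (s + j * p ^ r))"
        using lift[of s "s + j * p ^ r" r] by (simp add: cong_def)
      moreover have "s + j * p ^ r < p ^ (r + 1)"
      proof -
        have "s + j * p ^ r < (j + 1) * p ^ r" using s(1) by simp
        also have "\<dots> \<le> p * p ^ r" using child.hyps(3) by (intro mult_right_mono) auto
        finally show ?thesis by simp
      qed
      \<comment> \<open>Passing to a child prepends the leading digit \<open>j\<close> to
        \<open>s\<close>.\<close>
      moreover have "l' + j * totient (p ^ (r + 1)) = index (s + j * p ^ r)"
        unfolding tot s(2) by (simp only: distrib_left add_ac mult_ac)
      ultimately show ?case by (intro exI[of _ "s + j * p ^ r"]) auto
    qed
  next
    assume "\<exists>s<p ^ r. l' = index s \<and> ppow_dvd p (Suc r) (interp s)"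
    then obtain s where "s < p ^ r" "l' = index s" "ppow_dvd p (Suc r) (interp s)" by blast
    thus "(r, l') \<in> T0_nodes p l"
    proof (induction r arbitrary: s l')
      case 0
      thus ?case by (simp add: T0_nodes.root)
    next
      case (Suc r)
      \<comment> \<open>Dropping the leading digit yields the parent.\<close>
      define t where "t = s mod p ^ r"
      have t: "t < p ^ r" using p_gt_1 by (simp add: t_def)
      have ft: "ppow_dvd p (r + 2) (interp t)"
        using Suc.prems(3) lift[of t s r] by (simp add: t_def cong_def)
      hence "(r, index t) \<in> T0_nodes p l"
        using Suc.IH[OF t refl ppow_dvd_mono[OF ft]] by simp
      moreover have "(p, index t) \<in> Psi_irr (r + 2)"
        using Psi_irr_iff[OF less_le_trans[OF t pr]] ft by simp
      moreover have "s div p ^ r < p"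
        using Suc.prems(1) by (simp add: less_mult_imp_div_less)
      ultimately have "(r + 1, index t + s div p ^ r * totient (p ^ (r + 1))) \<in> T0_nodes p l"
        by (rule T0_nodes.child)
      moreover have "index t + s div p ^ r * totient (p ^ (r + 1)) = index (t + s div p ^ r * p ^ r)"
        unfolding tot by (simp only: distrib_left add_ac mult_ac)
      moreover have "t + s div p ^ r * p ^ r = s" unfolding t_def by (rule mod_div_mult_eq)
      ultimately show ?case using Suc.prems(2) by (simp only: Suc_eq_plus1)
    qed
  qed
qed

text \<open>Reducing \<open>index s\<close> modulo \<open>totient (p ^ (r + 1))\<close> reduces
  \<open>s\<close> modulo \<open>p ^ r\<close>, which does not affect divisibility of
  \<open>interp s\<close> by \<open>p ^ (r + 1)\<close>. So the node of height \<open>r\<close>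
  exists iff \<open>r + 1\<close> is at most the order.\<close>

lemma h0_eq:
  assumes f0: "ppow_dvd p 1 (interp 0)" and e: "ppow_dvd p 2 (interp 1 - interp 0)" and d: "ppow_exact p \<delta> (interp s)"
  shows "enat \<delta> = 1 + h0 p (index s)"
proof -
  have "\<delta> \<ge> 1"
    using ppow_dvd_interp_cong[of s 0 0 1] f0 ppow_exact_dvd_iff[OF d] by simp
  have "(r, index s mod totient (p ^ (r + 1))) \<in> T0_nodes p l \<longleftrightarrow> Suc r \<le> \<delta>" for r
  proof -
    have pr: "s mod p ^ r < p ^ r" using p_gt_1 by simp
    have "l + (p - 1) * (s mod p ^ r) < (p - 1) * Suc (s mod p ^ r)" using l_less by simp
    also have "\<dots> \<le> (p - 1) * p ^ r" using pr by (intro mult_left_mono) auto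
    finally have lt: "index (s mod p ^ r) < (p - 1) * p ^ r" .
    have "index s = index (p ^ r * (s div p ^ r) + s mod p ^ r)"
      by (simp only: mult_div_mod_eq)
    also have "\<dots> = index (s mod p ^ r) + (p - 1) * p ^ r * (s div p ^ r)"
      by (simp only: distrib_left add_ac mult_ac)
    finally have "index s mod ((p - 1) * p ^ r) = index (s mod p ^ r) mod ((p - 1) * p ^ r)"
      by (simp only: mod_mult_self2)
    hence m: "index s mod totient (p ^ (r + 1)) = index (s mod p ^ r)"
      using lt totient_eq[of r] by simp
    have inj: "index a = index b \<longleftrightarrow> a = b" for a b using p_gt_1 by auto
    have "(r, index s mod totient (p ^ (r + 1))) \<in> T0_nodes p l \<longleftrightarrow> ppow_dvd p (Suc r) (interp (s mod p ^ r))"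
      unfolding T0_nodes_iff[OF f0 e] m inj using pr by auto
    also have "\<dots> \<longleftrightarrow> ppow_dvd p (Suc r) (interp s)"
      by (intro ppow_dvd_interp_cong[of _ _ r]) (simp_all add: cong_def)
    finally show ?thesis using ppow_exact_dvd_iff[OF d] by simp
  qed
  moreover have "index s mod (p - 1) = l" using l_less by simp
  ultimately show ?thesis
    using one_plus_Sup_enat[OF \<open>\<delta> \<ge> 1\<close>] by (simp add: h0_def)
qed

end

section \<open>The unique p-adic zero\<close>

text \<open>By \<open>Psi_irr_iff\<close> and \<open>Delta_eq_0_iff\<close> this is the case of an
  irregular pair with \<open>Delta 1 p l\<close> nonzero.\<close>

locale simple_root = kummer_pair +
  assumes f0: "ppow_dvd p 1 (interp 0)" and slope: "\<not> ppow_dvd p 2 (interp 1 - interp 0)"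
begin

lemma slope_exact: "ppow_exact p 1 (interp 1 - interp 0)"
  using kummer_cong[of 0 1 0] slope by (simp add: ppow_exact_iff numeral_2_eq_2)

text \<open>If the arguments differ by \<open>p ^ k * v\<close>, the values differ by
  \<open>p ^ k * v\<close> times the slope modulo \<open>p ^ (k + 2)\<close>. The slope has order
  exactly 1, so one more factor \<open>p\<close> in the values forces \<open>p\<close> to divide
  \<open>v\<close>.\<close>

lemma interp_isometry: "ppow_dvd p (Suc k) (interp s' - interp s) \<longleftrightarrow> [s = s'] (mod p ^ k)"
proof
  show "[s = s'] (mod p ^ k)" if "ppow_dvd p (Suc k) (interp s' - interp s)"
    using that
  proof (induction k)
    case (Suc k)
    hence IH: "[s = s'] (mod p ^ k)" using ppow_dvd_mono[OF Suc.prems, of "Suc k"] by simp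
    have "int p ^ k dvd int s' - int s"
      using IH by (metis cong_iff_dvd_diff cong_int_iff cong_sym of_nat_power)
    then obtain v where v: "int s' - int s = int p ^ k * v" ..
    have "ppow_dvd p (k + 2) (interp s' - interp s)" using Suc.prems by simp
    hence "ppow_dvd p (k + 2) ((interp s' - interp s) - (interp s' - interp s - of_int (int s' - int s) * (interp 1 - interp 0)))"
      by (rule ppow_dvd_diff[OF prime_p _ kummer_cong_refined[OF f0 IH]])
    hence "ppow_dvd p (k + 2) (of_nat p ^ k * (of_int v * (interp 1 - interp 0)))"
      by (simp add: v mult.assoc)
    hence "ppow_dvd p 2 (of_int v * (interp 1 - interp 0))"
      by (simp only: ppow_dvd_prime_power_mult_iff[OF prime_p])
    hence "int p dvd v" using ppow_dvd_unit_mult_iff[OF prime_p] slope by blast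
    hence "int p ^ Suc k dvd int s' - int s" unfolding v by (simp add: mult.commute)
    thus ?case
      by (metis cong_iff_dvd_diff cong_int_iff cong_sym of_nat_power)
  qed simp
qed (rule kummer_cong)

text \<open>Hensel lifting, one digit at a time, with the refined congruence as linear
  approximation.\<close>

lemma exists_root: "\<exists>x<p ^ k. ppow_dvd p (Suc k) (interp x)"
proof (induction k)
  case 0
  show ?case using f0 by simp
next
  case (Suc k)
  then obtain x where x: "x < p ^ k" "ppow_dvd p (Suc k) (interp x)" by blast
  define e where "e = of_nat (p ^ k) * (interp 1 - interp 0)"
  have "ppow_exact p k (of_nat (p ^ k))"
    using p_gt_1 by (simp only: ppow_exact_iff ppow_dvd_of_nat_iff[OF prime_p]) (simp add: power_dvd_imp_le)
  hence e: "ppow_exact p (Suc k) e"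
    unfolding e_def using ppow_exact_mult[OF prime_p _ slope_exact] by fastforce
  hence e0: "e \<noteq> 0" by (simp add: ppow_exact_def)
  have "ppow_dvd p (Suc k + 0) (- interp x)" using x(2) ppow_dvd_minus[OF prime_p] by simp
  hence "ppow_dvd p 0 (- interp x / e)" by (rule ppow_dvd_divide_exact[OF prime_p e])
  \<comment> \<open>Here \<open>e\<close> is the change of value per unit of the new digit, and
    \<open>j\<close> solves \<open>interp x + j * e = 0\<close> to one further digit.\<close>
  then obtain j where j: "j < p" "ppow_dvd p 1 (of_nat j - (- interp x / e))"
    using ppow_dvd_residue_unique[OF prime_p] by blast
  have "ppow_dvd p (Suc k + 1) (e * (of_nat j - (- interp x / e)))"
    using e j(2) by (intro ppow_dvd_mult prime_p) (simp_all add: ppow_exact_iff)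
  hence "ppow_dvd p (k + 2) (of_nat j * e + interp x)"
    using e0 by (simp add: algebra_simps)
  hence "ppow_dvd p (k + 2) ((of_nat j * e + interp x)
      + (interp (x + p ^ k * j) - interp x - of_nat (p ^ k * j) * (interp 1 - interp 0)))"
    by (rule ppow_dvd_add[OF prime_p _ kummer_congruence_refined[OF f0]])
  hence "ppow_dvd p (Suc (Suc k)) (interp (x + p ^ k * j))"
    by (simp add: e_def algebra_simps)
  moreover have "x + p ^ k * j < p ^ Suc k"
  proof -
    have "x + p ^ k * j < p ^ k * Suc j" using x(1) by simp
    also have "\<dots> \<le> p ^ k * p" using j(1) by (intro mult_left_mono) auto
    finally show ?thesis by (simp add: mult.commute)
  qed
  ultimately show ?case by blast
qed

text \<open>By \<open>interp_isometry\<close> only one \<open>x\<close> qualifies, so the choice is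
  canonical: it is the zero of \<open>interp\<close> reduced modulo \<open>p ^ k\<close>.\<close>

definition root_mod :: "nat \<Rightarrow> nat" where
  "root_mod k = (SOME x. x < p ^ k \<and> ppow_dvd p (Suc k) (interp x))"

lemma root_mod: "root_mod k < p ^ k" "ppow_dvd p (Suc k) (interp (root_mod k))"
  using someI_ex[OF exists_root[of k, unfolded Bex_def]] by (simp_all add: root_mod_def)

lemma ppow_dvd_interp_iff_root: "ppow_dvd p (Suc k) (interp s) \<longleftrightarrow> s mod p ^ k = root_mod k"
proof -
  have "ppow_dvd p (Suc k) (interp s) \<longleftrightarrow> ppow_dvd p (Suc k) (interp s - interp (root_mod k))"
    using ppow_dvd_add[OF prime_p _ root_mod(2)[of k], of "interp s - interp (root_mod k)"]
      ppow_dvd_diff[OF prime_p _ root_mod(2)[of k], of "interp s"] by auto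
  thus ?thesis using root_mod(1)[of k] by (auto simp: interp_isometry cong_def)
qed

lemma root_mod_mod: "k \<le> m \<Longrightarrow> root_mod m mod p ^ k = root_mod k"
  using ppow_dvd_mono[OF root_mod(2)[of m], of "Suc k"] by (simp add: ppow_dvd_interp_iff_root)

text \<open>The residues are compatible, so the leading digit of \<open>root_mod (Suc i)\<close> is
  the digit of the zero at \<open>p ^ i\<close>.\<close>

lemma root_digits: "(\<Sum>i<k. root_mod (Suc i) div p ^ i * p ^ i) = root_mod k"
proof (induction k)
  case 0
  show ?case using root_mod(1)[of 0] by simp
next
  case (Suc k)
  thus ?case using root_mod_mod[of k "Suc k"] mod_mult_div_eq[of "root_mod (Suc k)" "p ^ k"]
    by (simp add: mult.commute)
qed

lemma root_digit_less: "root_mod (Suc i) div p ^ i < p"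
  using root_mod(1)[of "Suc i"] by (simp add: less_mult_imp_div_less)

text \<open>Any admissible sequence has partial digit sums that are reduced zeros, hence equal to
  \<open>root_mod k\<close>; successive sums then determine each digit.\<close>

lemma chi_digits_eq: "chi_digits p l = (\<lambda>i. case i of 0 \<Rightarrow> l | Suc j \<Rightarrow> root_mod (Suc j) div p ^ j)"
  unfolding chi_digits_def
proof (rule the_equality)
  let ?d = "\<lambda>i. case i of 0 \<Rightarrow> l | Suc j \<Rightarrow> root_mod (Suc j) div p ^ j"
  show "?d 0 = l \<and> (\<forall>m\<ge>1. (p, map ?d [0..<m]) \<in> Psi_irr_hat m)"
  proof (intro conjI allI impI)
    fix m :: nat assume "m \<ge> 1"
    then obtain k where m: "m = Suc k" by (cases m) auto
    show "(p, map ?d [0..<m]) \<in> Psi_irr_hat m"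
      unfolding m using root_digit_less root_mod(2)[of k]
      by (subst Psi_irr_hat_iff) (simp_all add: root_digits)
  qed simp
next
  fix s :: "nat \<Rightarrow> nat"
  assume s: "s 0 = l \<and> (\<forall>m\<ge>1. (p, map s [0..<m]) \<in> Psi_irr_hat m)"
  define t where "t k = (\<Sum>i<k. s (Suc i) * p ^ i)" for k
  have s': "(\<forall>i<k. s (Suc i) < p) \<and> ppow_dvd p (Suc k) (interp (t k))" for k
    using s Psi_irr_hat_iff[of s k] unfolding t_def by (metis le_add1 plus_1_eq_Suc)
  have t: "t k = root_mod k" for k
  proof -
    have "t k < p ^ k" unfolding t_def using s'[of k] by (intro digit_sum_less) auto
    thus ?thesis using s'[of k] by (simp add: ppow_dvd_interp_iff_root)
  qed
  have "s (Suc i) = root_mod (Suc i) div p ^ i" for i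
  proof -
    have "root_mod (Suc i) = root_mod i + s (Suc i) * p ^ i"
      using t[of "Suc i"] t[of i] by (simp add: t_def)
    thus ?thesis using root_mod(1)[of i] p_gt_1 by simp
  qed
  thus "s = (\<lambda>i. case i of 0 \<Rightarrow> l | Suc j \<Rightarrow> root_mod (Suc j) div p ^ j)"
    using s by (auto split: nat.split)
qed

lemma chi_eq: "chi p l = (\<lambda>k. int (root_mod k))"
  unfolding chi_def padic_suminf_def
proof (rule the_equality)
  have sum: "(\<Sum>\<nu><N. int (chi_digits p l (\<nu> + 1)) * int p ^ \<nu>) = int (root_mod N)" for N
    using arg_cong[OF root_digits[of N], of int] by (simp add: chi_digits_eq)
  have lim: "\<forall>\<^sub>F N in sequentially. padic_of_int p (\<Sum>\<nu><N. int (chi_digits p l (\<nu> + 1)) * int p ^ \<nu>) k = int (root_mod k)" for k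
    unfolding eventually_sequentially
  proof (intro exI allI impI)
    fix N assume "k \<le> N"
    show "padic_of_int p (\<Sum>\<nu><N. int (chi_digits p l (\<nu> + 1)) * int p ^ \<nu>) k = int (root_mod k)"
      unfolding sum padic_of_int_def using root_mod_mod[OF \<open>k \<le> N\<close>]
      by (metis of_nat_power zmod_int)
  qed
  have "int (root_mod k) < int p ^ k" for k using root_mod(1)[of k] by (metis of_nat_less_iff of_nat_power)
  moreover have "int (root_mod (Suc k)) mod int p ^ k = int (root_mod k)" for k
    using root_mod_mod[of k "Suc k"] by (metis of_nat_power zmod_int le_SucI order_refl)
  ultimately show "(\<lambda>k. int (root_mod k)) \<in> padic_ints p \<and>
      (\<forall>k. \<forall>\<^sub>F N in sequentially. padic_of_int p (\<Sum>\<nu><N. int (chi_digits p l (\<nu> + 1)) * int p ^ \<nu>) k = int (root_mod k))"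
    using lim by (simp add: padic_ints_def)
  fix x
  assume x: "x \<in> padic_ints p \<and>
      (\<forall>k. \<forall>\<^sub>F N in sequentially. padic_of_int p (\<Sum>\<nu><N. int (chi_digits p l (\<nu> + 1)) * int p ^ \<nu>) k = x k)"
  show "x = (\<lambda>k. int (root_mod k))"
  proof
    fix k
    \<comment> \<open>The equation no longer involves \<open>N\<close>, so holding eventually means
      holding.\<close>
    have "\<forall>\<^sub>F N in sequentially. x k = int (root_mod k)"
      using x[THEN conjunct2, THEN spec, of k] lim[of k] by eventually_elim simp
    thus "x k = int (root_mod k)" by simp
  qed
qed

text \<open>Component \<open>k\<close> of the difference vanishes iff \<open>s\<close> agrees with
  the zero modulo \<open>p ^ k\<close>, that is, iff \<open>p ^ Suc k\<close> divides
  \<open>interp s\<close>. The extra factor \<open>p\<close> gives the summand 1.\<close>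

lemma padic_ord_chi_minus:
  assumes d: "ppow_exact p \<delta> (interp s)"
  shows "enat \<delta> = 1 + padic_ord (padic_minus p (chi p l) (padic_of_int p (int s)))"
proof -
  have "padic_minus p (chi p l) (padic_of_int p (int s)) k = 0 \<longleftrightarrow> Suc k \<le> \<delta>" for k
  proof -
    have "padic_minus p (chi p l) (padic_of_int p (int s)) k = 0 \<longleftrightarrow> int (root_mod k) mod int p ^ k = int s mod int p ^ k"
      by (simp add: padic_minus_def padic_of_int_def chi_eq mod_diff_right_eq mod_eq_dvd_iff dvd_eq_mod_eq_0)
    also have "\<dots> \<longleftrightarrow> root_mod k mod p ^ k = s mod p ^ k"
      by (simp flip: of_nat_power zmod_int)
    also have "\<dots> \<longleftrightarrow> ppow_dvd p (Suc k) (interp s)"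
      using root_mod(1)[of k] by (auto simp: ppow_dvd_interp_iff_root)
    finally show ?thesis using ppow_exact_dvd_iff[OF d] by simp
  qed
  moreover have "\<delta> \<ge> 1"
    using ppow_dvd_interp_cong[of s 0 0 1] f0 ppow_exact_dvd_iff[OF d] by simp
  ultimately show ?thesis
    using one_plus_Sup_enat by (simp add: padic_ord_def)
qed

end

section \<open>The order of B_n at p\<close>

theorem theorem5p1:
  fixes n p r l :: nat
  assumes "even n" and "n > 0"
    and "prime p"
    and "r \<ge> 1" and "ppow_exact p r (of_nat n)"
    and "\<not> (p - 1) dvd n"
    and "[l = n] (mod (p - 1))" and "0 < l" and "l < p - 1"
  shows "\<exists>\<delta>::nat. ppow_exact p (r + \<delta>) (bernoulli n) \<and>
    (regular_prime p \<longrightarrow> \<delta> = 0) \<and>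
    (irregular_prime p \<and> (p, l) \<notin> Psi_irr 1 \<longrightarrow> \<delta> = 0) \<and>
    (irregular_prime p \<and> (p, l) \<in> Psi_irr 1 \<and> Delta 1 p l \<noteq> 0 \<longrightarrow>
       enat \<delta> = 1 + padic_ord (padic_minus p (chi p l)
                        (padic_of_int p ((int n - int l) div (int p - 1)))) \<and>
       ((p, [l, l]) \<notin> Psi_irr_hat 2 \<longrightarrow> \<delta> = 1) \<and>
       ((p, [l, l]) \<in> Psi_irr_hat 2 \<longrightarrow> \<delta> \<ge> 2)) \<and>
    (irregular_prime p \<and> (p, l) \<in> Psi_irr 1 \<and> Delta 1 p l = 0 \<longrightarrow>
       enat \<delta> = 1 + h0 p n \<and>
       ((p, [l, l]) \<notin> Psi_irr_hat 2 \<longrightarrow> \<delta> = 1) \<and>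
       ((p, [l, l]) \<in> Psi_irr_hat 2 \<longrightarrow> \<delta> \<ge> 2))"
proof -
  note p = \<open>prime p\<close>
  have p1: "p > 1" using prime_gt_1_nat[OF p] .
  have "odd p"
    using prime_odd_nat[OF p] \<open>0 < l\<close> \<open>l < p - 1\<close> by force
  have "l = n mod (p - 1)" using \<open>[l = n] (mod (p - 1))\<close> \<open>l < p - 1\<close> by (simp add: cong_def)
  define s where "s = n div (p - 1)"
  have n: "n = l + (p - 1) * s" using \<open>l = n mod (p - 1)\<close> by (simp add: s_def)
  have "even ((p - 1) * s)" using \<open>odd p\<close> by simp
  hence "even l" using \<open>even n\<close> n by simp
  interpret kummer_pair p l
    using p \<open>0 < l\<close> \<open>l < p - 1\<close> \<open>even l\<close> by unfold_locales
  have quot_n: "bernoulli_quot s = bernoulli n / of_nat n" using n by simp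
  have "bernoulli_quot s \<noteq> 0"
    unfolding quot_n using bernoulli_nonzero[OF \<open>even n\<close> \<open>n > 0\<close>] \<open>n > 0\<close> by simp
  moreover have "ppow_dvd p 0 (bernoulli_quot s)" using interp_integral by (simp only: ppow_dvd_quot_iff)
  ultimately obtain \<delta> where d: "ppow_exact p \<delta> (bernoulli_quot s)" using ppow_exact_exists by blast
  hence df: "ppow_exact p \<delta> (interp s)" unfolding ppow_exact_iff ppow_dvd_quot_iff .
  \<comment> \<open>So \<delta> is the order of \<open>B_n / n\<close>, finite because
    \<open>B_n\<close> is nonzero.\<close>
  have "of_nat n * bernoulli_quot s = bernoulli n" unfolding quot_n using \<open>n > 0\<close> by simp
  hence B: "ppow_exact p (r + \<delta>) (bernoulli n)"
    using ppow_exact_mult[OF p \<open>ppow_exact p r (of_nat n)\<close> d] by (simp only:)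
  have Psi: "(p, l) \<in> Psi_irr 1 \<longleftrightarrow> ppow_dvd p 1 (interp 0)"
    using Psi_irr_iff[of 0 0] by simp
  have "ppow_dvd p 1 (interp s) \<longleftrightarrow> ppow_dvd p 1 (interp 0)"
    by (intro ppow_dvd_interp_cong[of _ _ 0]) simp_all
  hence pos: "\<delta> \<ge> 1 \<longleftrightarrow> (p, l) \<in> Psi_irr 1"
    unfolding Psi ppow_exact_dvd_iff[OF df] .
  \<comment> \<open>Multiplying \<open>B_l / l\<close> by \<open>l\<close> keeps divisibility by
    \<open>p\<close>, so an irregular pair makes \<open>p\<close> irregular. With \<open>pos\<close>
    this settles the cases with \<delta> = 0.\<close>
  have reg: "(p, l) \<notin> Psi_irr 1" if "regular_prime p"
  proof
    assume "(p, l) \<in> Psi_irr 1"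
    hence "ppow_dvd p 1 (bernoulli l / of_nat l)" by (simp add: Psi_irr_def)
    hence "ppow_dvd p 1 (of_int (int l) * (bernoulli l / of_nat l))" by (rule ppow_dvd_int_mult[OF p])
    hence "ppow_dvd p 1 (bernoulli l)" using \<open>0 < l\<close> by simp
    moreover have "l \<le> p - 3" using \<open>l < p - 1\<close> \<open>even l\<close> \<open>odd p\<close> by presburger
    ultimately have "irregular_prime p"
      using p \<open>odd p\<close> \<open>even l\<close> l_ge_2 unfolding irregular_prime_def by blast
    thus False using that by (simp add: regular_prime_def)
  qed
  have "p ^ r dvd n"
    using \<open>ppow_exact p r (of_nat n)\<close> by (simp only: ppow_exact_iff ppow_dvd_of_nat_iff[OF p])
  hence "p dvd n" using \<open>r \<ge> 1\<close> dvd_trans[OF dvd_power] by fastforce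
  \<comment> \<open>As \<open>p - 1\<close> is -1 modulo \<open>p\<close>, divisibility of
    \<open>n\<close> by \<open>p\<close> forces \<open>s\<close> to be \<open>l\<close> modulo
    \<open>p\<close>; divisibility by \<open>p ^ 2\<close> can then be tested at
    \<open>interp l\<close>.\<close>
  moreover have "p * s = (p - 1) * s + s" using p1 by (cases p) auto
  hence "n + s = l + p * s" using n by simp
  ultimately have "[s = l] (mod p)"
    by (metis cong_def cong_add_rcancel_0_nat mod_mult_self2 mod_add_left_eq add_0 dvd_imp_mod_0)
  hence "ppow_dvd p 2 (interp s) \<longleftrightarrow> ppow_dvd p 2 (interp l)"
    by (intro ppow_dvd_interp_cong[of _ _ 1]) simp_all
  hence two: "\<delta> \<ge> 2 \<longleftrightarrow> (p, [l, l]) \<in> Psi_irr_hat 2"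
    unfolding Psi_irr_hat_double_iff ppow_exact_dvd_iff[OF df] .
  have s: "(int n - int l) div (int p - 1) = int s"
  proof -
    have "int n - int l = (int p - 1) * int s" using n p1 by (simp add: of_nat_diff)
    thus ?thesis using p1 by simp
  qed
  have 3: "enat \<delta> = 1 + padic_ord (padic_minus p (chi p l) (padic_of_int p (int s)))"
    if "(p, l) \<in> Psi_irr 1" "Delta 1 p l \<noteq> 0"
  proof -
    interpret simple_root p l
      using that Psi Delta_eq_0_iff by unfold_locales auto
    show ?thesis by (rule padic_ord_chi_minus[OF df])
  qed
  have 4: "enat \<delta> = 1 + h0 p n" if "(p, l) \<in> Psi_irr 1" "Delta 1 p l = 0"
    using h0_eq[OF _ _ df] that Psi Delta_eq_0_iff n by simp
  show ?thesis
    using B pos two reg 3 4 unfolding s by (intro exI[of _ \<delta>]) auto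
qed

end
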